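(* Let $q$ be a prime power, $m\ge 1$ an integer, and $k$ an integer with $0\le k\le m$. For $\alpha\in\mathbb{F}_{q^m}$ put $$\zeta_k(\alpha)=\sum_{\substack{f\mid x^m-1\\ \deg f=m-k}}\frac{\phi(f)}{q^m}\sum_{h\mid f}\frac{\mu(h)}{\phi(h)}\sum_{\substack{g\mid \frac{x^m-1}{f}\\ \gcd\left(h,\frac{x^m-1}{fg}\right)=1}}\ \sum_{\chi\in X_{hg}}\chi(\alpha),$$ where $f,h,g$ run over monic divisors in $\mathbb{F}_q[x]$ and $X_{hg}$ is the set of all additive characters of $\mathbb{F}_{q^m}$ of $\mathbb{F}_q$-Order $hg$. Then, for every $\alpha\in\mathbb{F}_{q^m}$, $\zeta_k(\alpha)=1$ if $\alpha$ is $k$-normal over $\mathbb{F}_q$, and $\zeta_k(\alpha)=0$ otherwise; that is, $\zeta_k$ is the characteristic function of the $k$-normal elements.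
   Context: For $\alpha\in\mathbb{F}_{q^m}$ let $g_\alpha(x)=\sum_{i=0}^{m-1}\alpha^{q^i}x^{m-1-i}\in\mathbb{F}_{q^m}[x]$. The element $\alpha$ is $k$-normal over $\mathbb{F}_q$ if $\gcd(x^m-1,g_\alpha(x))$, computed over $\mathbb{F}_{q^m}$, has degree $k$ (so that, with $\gcd(x^m-1,0)=x^m-1$, the element $0$ is the only $m$-normal element). For $l(x)=\sum_{i=0}^n a_i x^i\in\mathbb{F}_q[x]$ and $\gamma\in\mathbb{F}_{q^m}$, write $l\circ\gamma=\sum_{i=0}^n a_i\gamma^{q^i}$. An additive character of $\mathbb{F}_{q^m}$ is a group homomorphism $\chi:(\mathbb{F}_{q^m},+)\to\mathbb{C}^*$; its $\mathbb{F}_q$-Order is the unique monic polynomial $f\in\mathbb{F}_q[x]$ of least degree such that $\chi(f\circ\gamma)=1$ for all $\gamma\in\mathbb{F}_{q^m}$. For a nonzero $f\in\mathbb{F}_q[x]$: $\phi(f)$ is the number of polynomials in $\mathbb{F}_q[x]$ of degree less than $\deg f$ that are coprime to $f$ (with $\phi(1)=1$); $\mu(f)=(-1)^r$ if $f$ is the product of $r$ distinct irreducible polynomials (with $\mu(1)=1$), and $\mu(f)=0$ otherwise. *)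

theory Defs
  imports Complex_Main "HOL-Library.Cardinality" "HOL-Computational_Algebra.Computational_Algebra"
begin

text \<open>
  The field with \<open>q\<close> elements is a finite type \<open>'a\<close> (so \<open>q = CARD('a)\<close> is a prime power), its
  extension of degree \<open>m\<close> is a finite type \<open>'b\<close> with \<open>CARD('b) = CARD('a) ^ m\<close>, and the
  inclusion is a unital ring homomorphism \<open>emb :: 'a \<Rightarrow> 'b\<close>. The class \<^class>\<open>field_gcd\<close> puts no
  condition on a field: it only adds the (trivial) Euclidean structure that every field carries, which
  the library needs to provide \<^const>\<open>gcd\<close> on polynomials (normalised to be monic or zero).
\<close>

definition x_pow_minus_one :: "nat \<Rightarrow> 'a::comm_ring_1 poly"
  where "x_pow_minus_one m = monom 1 m - 1"

definition normal_poly :: "nat \<Rightarrow> nat \<Rightarrow> 'b::comm_ring_1 \<Rightarrow> 'b poly"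
  where "normal_poly q m \<alpha> = (\<Sum>i<m. monom (\<alpha> ^ (q ^ i)) (m - 1 - i))"

definition k_normal :: "nat \<Rightarrow> nat \<Rightarrow> nat \<Rightarrow> 'b::field_gcd \<Rightarrow> bool"
  where "k_normal q m k \<alpha> \<longleftrightarrow> degree (gcd (x_pow_minus_one m) (normal_poly q m \<alpha>)) = k"

definition lin_app ::
    "('a::{field_gcd,finite} \<Rightarrow> 'b::{field_gcd,finite}) \<Rightarrow> 'a poly \<Rightarrow> 'b \<Rightarrow> 'b"
  where "lin_app emb l \<gamma> = (\<Sum>i\<le>degree l. emb (coeff l i) * \<gamma> ^ (CARD('a) ^ i))"

definition additive_character :: "('b::ab_group_add \<Rightarrow> complex) \<Rightarrow> bool"
  where "additive_character \<chi> \<longleftrightarrow> (\<forall>x. \<chi> x \<noteq> 0) \<and> (\<forall>x y. \<chi> (x + y) = \<chi> x * \<chi> y)"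

definition annihilates_char ::
    "('a::{field_gcd,finite} \<Rightarrow> 'b::{field_gcd,finite}) \<Rightarrow> 'a poly \<Rightarrow> ('b \<Rightarrow> complex) \<Rightarrow> bool"
  where "annihilates_char emb f \<chi> \<longleftrightarrow> (\<forall>\<gamma>. \<chi> (lin_app emb f \<gamma>) = 1)"

definition Fq_Order ::
    "('a::{field_gcd,finite} \<Rightarrow> 'b::{field_gcd,finite}) \<Rightarrow> ('b \<Rightarrow> complex) \<Rightarrow> 'a poly"
  where "Fq_Order emb \<chi> =
    (THE f. lead_coeff f = 1 \<and> annihilates_char emb f \<chi> \<and>
       (\<forall>f'. lead_coeff f' = 1 \<and> annihilates_char emb f' \<chi> \<longrightarrow> degree f \<le> degree f'))"

definition chars_of_Order ::
    "('a::{field_gcd,finite} \<Rightarrow> 'b::{field_gcd,finite}) \<Rightarrow> 'a poly \<Rightarrow> ('b \<Rightarrow> complex) set"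
  where "chars_of_Order emb f = {\<chi>. additive_character \<chi> \<and> Fq_Order emb \<chi> = f}"

text \<open>
  The zero polynomial counts as having degree below that of every nonzero polynomial, whereas
  \<^term>\<open>degree 0 = (0 :: nat)\<close> in the library; hence the first disjunct, which also gives
  \<open>poly_phi 1 = 1\<close>.
\<close>

definition poly_phi :: "'a::{field_gcd,finite} poly \<Rightarrow> nat"
  where "poly_phi f = card {p. (p = 0 \<or> degree p < degree f) \<and> coprime p f}"

text \<open>
  Irreducible factors are counted up to units, so they are taken monic and the leading
  coefficient is split off.
\<close>

definition distinct_irreducible_factors :: "'a::{field_gcd,finite} poly \<Rightarrow> 'a poly set \<Rightarrow> bool"
  where "distinct_irreducible_factors f P \<longleftrightarrow>
    finite P \<and> (\<forall>p\<in>P. irreducible p \<and> lead_coeff p = 1) \<and> f = smult (lead_coeff f) (\<Prod>P)"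

definition poly_mu :: "'a::{field_gcd,finite} poly \<Rightarrow> int"
  where "poly_mu f =
    (if f \<noteq> 0 \<and> (\<exists>P. distinct_irreducible_factors f P)
     then (-1) ^ card (THE P. distinct_irreducible_factors f P) else 0)"

definition monic_divisors :: "'a::{field_gcd,finite} poly \<Rightarrow> 'a poly set"
  where "monic_divisors f = {d. lead_coeff d = 1 \<and> d dvd f}"

definition zeta ::
    "('a::{field_gcd,finite} \<Rightarrow> 'b::{field_gcd,finite}) \<Rightarrow> nat \<Rightarrow> nat \<Rightarrow> 'b \<Rightarrow> complex"
  where "zeta emb m k \<alpha> =
    (\<Sum>f \<in> {f \<in> monic_divisors (x_pow_minus_one m). degree f = m - k}.
       of_nat (poly_phi f) / of_nat (CARD('a) ^ m) *
       (\<Sum>h \<in> monic_divisors f.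
          of_int (poly_mu h) / of_nat (poly_phi h) *
          (\<Sum>g \<in> {g \<in> monic_divisors (x_pow_minus_one m div f).
                    gcd h (x_pow_minus_one m div (f * g)) = 1}.
             \<Sum>\<chi> \<in> chars_of_Order emb (h * g). \<chi> \<alpha>)))"

end

theory Submission
  imports Defs
begin

text \<open>
  Write \<open>q = CARD('a)\<close> and \<open>N = x\<^sup>m - 1\<close>. Under \<open>l \<circ> \<gamma>\<close> the field \<open>'b\<close> is a module over
  \<open>\<F>\<^sub>q[x]\<close> that is annihilated by \<open>N\<close>, and every \<open>\<alpha>\<close> has an order \<open>d\<close>: the monic divisor of \<open>N\<close>
  with \<open>l \<circ> \<alpha> = 0\<close> exactly if \<open>d\<close> divides \<open>l\<close>. Two facts make up the proof.

  The element \<open>\<alpha>\<close> is \<open>k\<close>-normal exactly if \<open>deg d = m - k\<close> (\<open>degree_gcd_normal_poly\<close>). Modulo \<open>N\<close>,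
  multiplying \<open>g\<^sub>\<alpha>\<close> by \<open>x\<close> gives \<open>g\<close> of \<open>\<alpha>\<^sup>q\<close>, so \<open>N\<close> divides \<open>l g\<^sub>\<alpha>\<close> for \<open>l \<in> \<F>\<^sub>q[x]\<close> exactly if
  \<open>l \<circ> \<alpha> = 0\<close>. The cofactor \<open>N / gcd(N, g\<^sub>\<alpha>)\<close> generates the ideal of all \<open>l\<close> with \<open>N | l g\<^sub>\<alpha>\<close> over
  \<open>'b\<close>; that ideal is stable under the Frobenius map, so its monic generator has coefficients in
  \<open>\<F>\<^sub>q\<close> and is \<open>d\<close>.

  The summand of \<open>\<zeta>\<^sub>k(\<alpha>)\<close> that belongs to a divisor \<open>f\<close> is \<open>1\<close> if \<open>d = f\<close> and \<open>0\<close> otherwise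
  (\<open>zeta_term_eq\<close>); summing over the \<open>f\<close> of degree \<open>m - k\<close> then proves the claim. The analytic input
  is the orthogonality relation
  \<open>\<Sum>\<chi>(\<alpha>) = q\<^bsup>deg c\<^esup> [(N/c) \<circ> \<alpha> = 0]\<close>, where \<open>\<chi>\<close> runs over the characters whose Order divides \<open>c\<close>
  (\<open>sum_characters_Order_dvd\<close>). These are the characters that are trivial on the subgroup
  \<open>c \<circ> 'b\<close>, and that subgroup is the kernel of \<open>N/c\<close> by counting: a kernel of \<open>l\<close> is the zero set
  of a polynomial of degree \<open>q\<^bsup>deg l\<^esup>\<close>, which leaves no room for strict inclusion.

  The rest is inclusion and exclusion over sets of primes. With \<open>e = N/f\<close>, only squarefree
  \<open>h = \<Prod>A\<close> with \<open>A\<close> a set of prime divisors of \<open>f\<close> contribute, and the Orders \<open>h g\<close> admitted by the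
  condition on \<open>g\<close> are exactly the divisors of \<open>e h\<close> that divide no \<open>e h / p\<close> with \<open>p \<in> A\<close>
  (\<open>order_factorisation_iff\<close>). Hence the characters of these Orders contribute an alternating sum
  over \<open>U \<subseteq> A\<close> of \<open>q\<^bsup>deg(e \<Prod>U)\<^esup> [d \<Prod>U | f]\<close>. Exchanging the summations over \<open>A\<close> and \<open>U\<close> turns the
  weights \<open>\<mu>(h)/\<phi>(h)\<close> into a constant that cancels \<open>\<phi>(f)/q\<^sup>m\<close>
  (\<open>weighted_moebius_cancellation\<close>), and what remains is
  \<open>\<Sum>\<^sub>U (-1)\<^bsup>|U|\<^esup> [d \<Prod>U | f] = [d = f]\<close> (\<open>sum_moebius_order\<close>).
\<close>

section \<open>Powers in finite fields\<close>

lemma card_ge_2: "CARD('c::{field,finite}) \<ge> 2"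
proof -
  have "card {0, 1::'c} \<le> CARD('c)"
    by (rule card_mono) auto
  then show ?thesis by simp
qed

lemma power_card_eq_self:
  fixes x :: "'c::{field,finite}"
  shows "x ^ CARD('c) = x"
proof (cases "x = 0")
  case False
  let ?U = "UNIV - {0::'c}"
  have "(\<Prod>y\<in>?U. x * y) = (\<Prod>y\<in>?U. y)"
    by (rule prod.reindex_bij_witness[of _ "\<lambda>y. y / x" "\<lambda>y. x * y"]) (use False in auto)
  then have "x ^ card ?U * (\<Prod>y\<in>?U. y) = 1 * (\<Prod>y\<in>?U. y)"
    by (simp add: prod.distrib)
  moreover have "(\<Prod>y\<in>?U. y) \<noteq> 0"
    by simp
  ultimately have "x ^ card ?U = 1"
    using mult_right_cancel by blast
  moreover have "CARD('c) = Suc (card ?U)"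
    using card_ge_2[where 'c='c] by (simp add: card_Diff_singleton)
  ultimately show ?thesis
    by (metis power_Suc mult.right_neutral)
qed (use card_ge_2[where 'c='c] in \<open>simp add: power_0_left\<close>)

text \<open>
  The terms of \<open>(x + 1)\<^sup>q\<close> strictly between the two ends form a polynomial of degree below \<open>q\<close>. By
  Fermat's identity it vanishes at all \<open>q\<close> elements of the field, so all its coefficients are zero.
  This is what makes the \<open>q\<close>-th power map additive, also on the extension field.
\<close>

lemma of_nat_choose_card_eq_0:
  assumes "0 < i" "i < CARD('c)"
  shows "of_nat (CARD('c) choose i) = (0 :: 'c::{field,finite})"
proof -
  let ?q = "CARD('c)"
  define P :: "'c poly" where "P = (\<Sum>j\<in>{1..<?q}. monom (of_nat (?q choose j)) j)"
  have root: "poly P a = 0" for a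
  proof -
    have "{..?q} = insert 0 (insert ?q {1..<?q})"
      using card_ge_2[where 'c='c] by auto
    then have "(a + 1) ^ ?q = 1 + (a ^ ?q + poly P a)"
      unfolding binomial_ring P_def poly_sum poly_monom
      using card_ge_2[where 'c='c] by (simp add: sum.insert)
    then show ?thesis
      by (simp only: power_card_eq_self) algebra
  qed
  have "degree P \<le> ?q - 1"
    unfolding P_def by (rule degree_sum_le) (auto intro: order.trans[OF degree_monom_le])
  then have deg: "degree P < ?q"
    using card_ge_2[where 'c='c] by linarith
  have "P = 0"
  proof (rule ccontr)
    assume "P \<noteq> 0"
    then have "card {a. poly P a = 0} \<le> degree P"
      by (rule card_poly_roots_bound)
    with root deg show False by simp
  qed
  then have "coeff P i = 0" by simp
  then show ?thesis
    unfolding P_def using assms by (simp add: coeff_sum)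
qed

section \<open>The extension field as a module over polynomials\<close>

lemma card_eq_card_ker_times_card_range:
  fixes f :: "'c::{ab_group_add,finite} \<Rightarrow> 'd::{ab_group_add,finite}"
  assumes add: "\<And>x y. f (x + y) = f x + f y"
  shows "CARD('c) = card {x. f x = 0} * card (range f)"
proof -
  have diff: "f (x - y) = f x - f y" for x y
    using add[of "x - y" y] by simp
  have "CARD('c) = (\<Sum>y\<in>range f. card {x. f x = y})"
  proof -
    have "UNIV = (\<Union>y\<in>range f. {x. f x = y})" by auto
    also have "card \<dots> = (\<Sum>y\<in>range f. card {x. f x = y})"
      by (rule card_UN_disjoint) auto
    finally show ?thesis .
  qed
  also have "\<dots> = (\<Sum>y\<in>range f. card {x. f x = 0})"
  proof (rule sum.cong[OF refl])
    fix y assume "y \<in> range f"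
    then obtain x0 where x0: "y = f x0" by auto
    show "card {x. f x = y} = card {x. f x = 0}"
      by (rule bij_betw_same_card[of "\<lambda>x. x - x0"], rule bij_betwI[of _ _ _ "\<lambda>x. x + x0"])
        (auto simp: x0 diff add)
  qed
  finally show ?thesis by simp
qed

lemma x_pow_minus_one_monic:
  assumes "m \<ge> 1"
  shows "degree (x_pow_minus_one m :: 'c::{comm_ring_1} poly) = m"
    and "lead_coeff (x_pow_minus_one m :: 'c poly) = 1"
proof -
  have "degree (monom 1 m - 1 :: 'c poly) = degree (monom 1 m + (- 1) :: 'c poly)" by simp
  also have "\<dots> = m"
    using assms by (subst degree_add_eq_left) (simp_all add: degree_monom_eq)
  finally show "degree (x_pow_minus_one m :: 'c poly) = m" by (simp add: x_pow_minus_one_def)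
  then show "lead_coeff (x_pow_minus_one m :: 'c poly) = 1"
    using assms by (simp add: x_pow_minus_one_def)
qed

locale finite_field_extension =
  fixes emb :: "'a::{field_gcd,finite} \<Rightarrow> 'b::{field_gcd,finite}" and m :: nat
  assumes emb_one [simp]: "emb 1 = 1"
    and emb_add: "emb (x + y) = emb x + emb y"
    and emb_mult: "emb (x * y) = emb x * emb y"
    and card_ext: "CARD('b) = CARD('a) ^ m"
    and m_pos: "m \<ge> 1"
begin

abbreviation xm1 :: "'a poly" where "xm1 \<equiv> x_pow_minus_one m"

lemma emb_zero [simp]: "emb 0 = 0"
  using emb_add[of 0 0] by (metis add.right_neutral add_left_cancel)

lemma emb_diff: "emb (x - y) = emb x - emb y"
  using emb_add[of "x - y" y] by simp

lemma emb_of_nat: "emb (of_nat n) = of_nat n"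
  by (induction n) (simp_all add: emb_add)

lemma emb_power: "emb (x ^ n) = emb x ^ n"
  by (induction n) (simp_all add: emb_mult)

lemma emb_eq_0_iff [simp]: "emb x = 0 \<longleftrightarrow> x = 0"
proof
  assume "emb x = 0"
  show "x = 0"
  proof (rule ccontr)
    assume "x \<noteq> 0"
    then have "emb x * emb (inverse x) = 1"
      by (simp flip: emb_mult)
    with \<open>emb x = 0\<close> show False by simp
  qed
qed simp

lemma inj_emb: "inj emb"
  by (rule injI) (metis emb_diff emb_eq_0_iff right_minus_eq)

lemma power_q_power_m [simp]: "(x :: 'b) ^ (CARD('a) ^ m) = x"
  using power_card_eq_self[of x] by (simp add: card_ext)

lemma emb_power_q_power [simp]: "emb a ^ (CARD('a) ^ i) = emb a"
  by (induction i) (simp_all add: power_mult power_card_eq_self mult.commute flip: emb_power)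

lemma power_q_add: "((x :: 'b) + y) ^ CARD('a) = x ^ CARD('a) + y ^ CARD('a)"
proof -
  have "{..CARD('a)} = insert 0 (insert CARD('a) {1..<CARD('a)})"
    using card_ge_2[where 'c='a] by auto
  moreover have "of_nat (CARD('a) choose i) = (0 :: 'b)" if "i \<in> {1..<CARD('a)}" for i
    using of_nat_choose_card_eq_0[where 'c='a, of i] that emb_of_nat[of "CARD('a) choose i"] by auto
  ultimately show ?thesis
    unfolding binomial_ring using card_ge_2[where 'c='a] by (simp add: sum.insert add.commute)
qed

lemma power_q_power_add: "((x :: 'b) + y) ^ (CARD('a) ^ i) = x ^ (CARD('a) ^ i) + y ^ (CARD('a) ^ i)"
  by (induction i) (simp_all add: power_mult power_q_add mult.commute[of "CARD('a)"])

lemma power_q_power_sum: "(\<Sum>x\<in>A. (f x :: 'b)) ^ (CARD('a) ^ i) = (\<Sum>x\<in>A. f x ^ (CARD('a) ^ i))"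
  by (induction A rule: infinite_finite_induct) (simp_all add: power_q_power_add)

text \<open>
  The image of the small field consists of roots of \<open>y\<^sup>q - y\<close> and has as many elements as that
  polynomial can have roots. This is the descent criterion for polynomials with Frobenius-invariant
  coefficients.
\<close>

lemma power_q_eq_self_iff: "(y :: 'b) ^ CARD('a) = y \<longleftrightarrow> y \<in> range emb"
proof -
  define P :: "'b poly" where "P = monom 1 CARD('a) - monom 1 1"
  have "coeff P CARD('a) = 1"
    unfolding P_def using card_ge_2[where 'c='a] by simp
  then have "P \<noteq> 0" by auto
  have "degree P \<le> CARD('a)"
    unfolding P_def using card_ge_2[where 'c='a]
    by (intro degree_diff_le) (simp_all add: degree_monom_eq)
  moreover have "card {y. poly P y = 0} \<le> degree P"
    using \<open>P \<noteq> 0\<close> by (rule card_poly_roots_bound)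
  moreover have "{y. poly P y = 0} = {y. y ^ CARD('a) = y}"
    by (simp add: P_def poly_monom)
  moreover have "card (range emb) = CARD('a)"
    using inj_emb by (simp add: card_image)
  moreover have "range emb \<subseteq> {y. y ^ CARD('a) = y}"
    using emb_power_q_power[of _ 1] by auto
  ultimately have "range emb = {y. y ^ CARD('a) = y}"
    by (intro card_seteq) auto
  then show ?thesis by auto
qed

abbreviation la :: "'a poly \<Rightarrow> 'b \<Rightarrow> 'b" where "la \<equiv> lin_app emb"

lemma lin_app_altdef:
  assumes "degree l \<le> n"
  shows "la l \<gamma> = (\<Sum>i\<le>n. emb (coeff l i) * \<gamma> ^ (CARD('a) ^ i))"
  unfolding lin_app_def
  by (rule sum.mono_neutral_left) (use assms in \<open>auto simp: coeff_eq_0 not_le\<close>)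

lemma lin_app_add: "la (p + r) \<gamma> = la p \<gamma> + la r \<gamma>"
proof -
  let ?n = "max (degree p) (degree r)"
  have "degree (p + r) \<le> ?n" by (rule degree_add_le_max)
  then show ?thesis
    by (simp add: lin_app_altdef[of _ ?n] emb_add ring_distribs sum.distrib)
qed

lemma lin_app_0_left [simp]: "la 0 \<gamma> = 0"
  by (simp add: lin_app_def)

lemma lin_app_diff: "la (p - r) \<gamma> = la p \<gamma> - la r \<gamma>"
  using lin_app_add[of "p - r" r \<gamma>] by simp

lemma lin_app_smult: "la (smult c p) \<gamma> = emb c * la p \<gamma>"
  by (simp add: lin_app_altdef[of _ "degree p"] degree_smult_le emb_mult sum_distrib_left mult.assoc)

lemma lin_app_add_right: "la p (\<gamma> + \<delta>) = la p \<gamma> + la p \<delta>"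
  by (simp add: lin_app_def power_q_power_add ring_distribs sum.distrib)

lemma lin_app_0_right [simp]: "la p 0 = 0"
  using lin_app_add_right[of p 0 0] by (metis add.right_neutral add_left_cancel)

lemma lin_app_shift: "la (pCons 0 p) \<gamma> = (la p \<gamma>) ^ CARD('a)"
proof -
  have "la (pCons 0 p) \<gamma> = (\<Sum>i\<le>Suc (degree p). emb (coeff (pCons 0 p) i) * \<gamma> ^ (CARD('a) ^ i))"
    by (rule lin_app_altdef) (rule degree_pCons_le)
  also have "\<dots> = (\<Sum>i\<le>degree p. emb (coeff p i) * \<gamma> ^ (CARD('a) ^ Suc i))"
    by (subst sum.atMost_Suc_shift) simp
  also have "\<dots> = (la p \<gamma>) ^ (CARD('a) ^ 1)"
    unfolding lin_app_def power_q_power_sum power_mult_distrib emb_power_q_power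
    by (simp add: power_mult[symmetric] mult.commute)
  finally show ?thesis by simp
qed

lemma lin_app_pCons: "la (pCons a p) \<gamma> = emb a * \<gamma> + (la p \<gamma>) ^ CARD('a)"
proof -
  have "la (pCons a p) \<gamma> = la ([:a:] + pCons 0 p) \<gamma>" by simp
  also have "\<dots> = la [:a:] \<gamma> + (la p \<gamma>) ^ CARD('a)" by (simp only: lin_app_add lin_app_shift)
  also have "la [:a:] \<gamma> = emb a * \<gamma>" by (simp add: lin_app_def)
  finally show ?thesis .
qed

text \<open>
  Together with additivity this makes the extension field a module over the polynomial ring. It rests
  on the \<open>q\<close>-th power map being additive and fixing the small field.
\<close>

lemma lin_app_mult: "la (p * r) \<gamma> = la p (la r \<gamma>)"
proof (induction p)
  case (pCons a p)
  then show ?case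
    by (simp add: mult_pCons_left lin_app_add lin_app_smult lin_app_shift lin_app_pCons)
qed simp

lemma lin_app_xm1 [simp]: "la xm1 \<gamma> = 0"
proof -
  have "la (monom 1 m) \<gamma> = (\<Sum>i\<le>m. if i = m then \<gamma> ^ (CARD('a) ^ i) else 0)"
    unfolding lin_app_altdef[OF degree_monom_le] by (rule sum.cong) auto
  moreover have "la 1 \<gamma> = \<gamma>"
    by (simp add: lin_app_def)
  ultimately show ?thesis
    by (simp add: x_pow_minus_one_def lin_app_diff)
qed

lemmas xm1_monic = x_pow_minus_one_monic[OF m_pos, where 'c='a]

lemma card_ker_lin_app_le:
  assumes "c \<noteq> 0"
  shows "card {\<gamma>. la c \<gamma> = 0} \<le> CARD('a) ^ degree c"
proof -
  define P :: "'b poly" where "P = (\<Sum>i\<le>degree c. monom (emb (coeff c i)) (CARD('a) ^ i))"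
  have "coeff P (CARD('a) ^ degree c)
      = (\<Sum>i\<le>degree c. if i = degree c then emb (coeff c i) else 0)"
    unfolding P_def coeff_sum using card_ge_2[where 'c='a]
    by (intro sum.cong) (auto simp: power_inject_exp)
  then have "P \<noteq> 0"
    using assms by auto
  then have "card {\<gamma>. poly P \<gamma> = 0} \<le> degree P"
    by (rule card_poly_roots_bound)
  also have "degree P \<le> CARD('a) ^ degree c"
    unfolding P_def using card_ge_2[where 'c='a]
    by (intro degree_sum_le) (auto intro: order.trans[OF degree_monom_le] power_increasing)
  also have "{\<gamma>. poly P \<gamma> = 0} = {\<gamma>. la c \<gamma> = 0}"
    by (simp add: P_def poly_sum poly_monom lin_app_def)
  finally show ?thesis .
qed

text \<open>
  Since \<open>c e = N\<close> acts as zero, the image of \<open>c\<close> lies in the kernel of \<open>e\<close>. The kernel of \<open>c\<close> has at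
  most \<open>q\<^bsup>deg c\<^esup>\<close> elements, so its image has at least \<open>q\<^bsup>deg e\<^esup>\<close>, which is also the most that the kernel of
  \<open>e\<close> can have; hence equality throughout.
\<close>

lemma range_lin_app:
  assumes ce: "xm1 = c * e"
  shows "range (la c) = {\<gamma>. la e \<gamma> = 0}" and "card (range (la c)) = CARD('a) ^ degree e"
proof -
  have nz: "c \<noteq> 0" "e \<noteq> 0" using ce xm1_monic by auto
  then have deg: "degree c + degree e = m"
    using ce xm1_monic(1) by (simp add: degree_mult_eq)
  have "la e (la c \<gamma>) = 0" for \<gamma>
    by (metis ce lin_app_mult lin_app_xm1 mult.commute)
  then have sub: "range (la c) \<subseteq> {\<gamma>. la e \<gamma> = 0}"
    by auto
  have "CARD('a) ^ degree c * CARD('a) ^ degree e = card {\<gamma>. la c \<gamma> = 0} * card (range (la c))"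
    using card_eq_card_ker_times_card_range[of "la c", OF lin_app_add_right] card_ext deg
    by (simp add: power_add[symmetric])
  also have "\<dots> \<le> CARD('a) ^ degree c * card (range (la c))"
    using card_ker_lin_app_le[OF nz(1)] by simp
  finally have ge: "CARD('a) ^ degree e \<le> card (range (la c))"
    by simp
  show eq: "range (la c) = {\<gamma>. la e \<gamma> = 0}"
    using sub ge card_ker_lin_app_le[OF nz(2)] by (intro card_seteq) auto
  show "card (range (la c)) = CARD('a) ^ degree e"
    using ge card_ker_lin_app_le[OF nz(2)] eq by simp
qed

end

section \<open>Additive characters of a finite field\<close>

definition add_subgroup :: "'c::ab_group_add set \<Rightarrow> bool"
  where "add_subgroup H \<longleftrightarrow> 0 \<in> H \<and> (\<forall>x\<in>H. \<forall>y\<in>H. x - y \<in> H)"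

lemma add_subgroupI [intro?]: "0 \<in> H \<Longrightarrow> (\<And>x y. x \<in> H \<Longrightarrow> y \<in> H \<Longrightarrow> x - y \<in> H) \<Longrightarrow> add_subgroup H"
  by (simp add: add_subgroup_def)

context
  fixes H :: "'c::ab_group_add set"
  assumes H: "add_subgroup H"
begin

lemma add_subgroup_zero: "0 \<in> H"
  using H by (simp add: add_subgroup_def)

lemma add_subgroup_diff: "x \<in> H \<Longrightarrow> y \<in> H \<Longrightarrow> x - y \<in> H"
  using H by (simp add: add_subgroup_def)

lemma add_subgroup_uminus: "x \<in> H \<Longrightarrow> - x \<in> H"
  using add_subgroup_diff[OF add_subgroup_zero, of x] by simp

lemma add_subgroup_add: "x \<in> H \<Longrightarrow> y \<in> H \<Longrightarrow> x + y \<in> H"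
  using add_subgroup_diff[OF _ add_subgroup_uminus, of x y] by simp

end

lemma add_subgroup_of_int_mult:
  fixes H :: "'c::ring_1 set"
  assumes "add_subgroup H" "x \<in> H"
  shows "of_int i * x \<in> H"
proof (induction i rule: int_induct[where k = 0])
  case base
  then show ?case using add_subgroup_zero[OF assms(1)] by simp
next
  case (step1 i)
  then show ?case using add_subgroup_add[OF assms(1) step1(2) assms(2)] by (simp add: algebra_simps)
next
  case (step2 i)
  then show ?case using add_subgroup_diff[OF assms(1) step2(2) assms(2)] by (simp add: algebra_simps)
qed

lemma additive_character_zero: "additive_character \<chi> \<Longrightarrow> \<chi> 0 = 1"
  unfolding additive_character_def by (metis add.right_neutral mult_cancel_left2)

lemma additive_character_uminus: "additive_character \<chi> \<Longrightarrow> \<chi> (- x) = inverse (\<chi> x)"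
  using additive_character_zero[of \<chi>] unfolding additive_character_def
  by (metis add.right_inverse inverse_unique)

lemma additive_character_diff: "additive_character \<chi> \<Longrightarrow> \<chi> (x - y) = \<chi> x / \<chi> y"
  using additive_character_uminus[of \<chi> y] unfolding additive_character_def
  by (metis diff_conv_add_uminus divide_inverse)

lemma sum_character_over_subgroup:
  fixes \<psi> :: "'c::{ab_group_add,finite} \<Rightarrow> complex"
  assumes \<psi>: "additive_character \<psi>" and H: "add_subgroup H"
  shows "(\<Sum>x\<in>H. \<psi> x) = (if \<forall>x\<in>H. \<psi> x = 1 then of_nat (card H) else 0)"
proof (cases "\<forall>x\<in>H. \<psi> x = 1")
  case False
  then obtain a where a: "a \<in> H" "\<psi> a \<noteq> 1" by auto
  have "(\<Sum>x\<in>H. \<psi> x) = (\<Sum>x\<in>H. \<psi> (a + x))"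
    by (rule sum.reindex_bij_witness[of _ "\<lambda>x. a + x" "\<lambda>x. x - a"])
      (use a add_subgroup_add[OF H] add_subgroup_diff[OF H] in auto)
  also have "\<dots> = \<psi> a * (\<Sum>x\<in>H. \<psi> x)"
    using \<psi> by (simp add: additive_character_def sum_distrib_left)
  finally have "(\<psi> a - 1) * (\<Sum>x\<in>H. \<psi> x) = 0"
    by (simp add: algebra_simps)
  then show ?thesis using a(2) False by auto
qed simp

text \<open>
  Take a maximal proper subgroup \<open>H\<close> and \<open>x\<close> outside of it. Then every \<open>y\<close> is \<open>h + i x\<close> with \<open>h \<in> H\<close>,
  and \<open>i\<close> is unique modulo the least \<open>n > 0\<close> with \<open>n x \<in> H\<close>, so \<open>y \<mapsto> cis (2 \<pi> i / n)\<close> is a character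
  that is trivial on \<open>H\<close> but not at \<open>x\<close>.
\<close>

lemma exists_nontrivial_additive_character:
  "\<exists>\<chi> :: 'c::{field,finite} \<Rightarrow> complex. additive_character \<chi> \<and> (\<exists>x. \<chi> x \<noteq> 1)"
proof -
  define S where "S = {H :: 'c set. add_subgroup H \<and> H \<noteq> UNIV}"
  have "(1 :: 'c) \<notin> {0}" by simp
  then have "{0 :: 'c} \<noteq> UNIV" by (metis UNIV_I)
  then have "{0} \<in> S"
    by (simp add: S_def add_subgroup_def)
  then obtain H where HS: "H \<in> S" and max: "\<And>K. K \<in> S \<Longrightarrow> H \<subseteq> K \<Longrightarrow> H = K"
    using finite_has_maximal[of S] by auto
  have H: "add_subgroup H" using HS by (simp add: S_def)
  obtain x where x: "x \<notin> H" using HS by (auto simp: S_def)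
  \<comment> \<open>By maximality, \<open>H\<close> and \<open>x\<close> together generate the whole group.\<close>
  have gen: "\<exists>i::int. y - of_int i * x \<in> H" for y
  proof -
    define K where "K = {y. \<exists>i::int. y - of_int i * x \<in> H}"
    have "add_subgroup K"
    proof
      show "0 \<in> K"
        unfolding K_def using add_subgroup_zero[OF H] by (auto intro!: exI[of _ 0])
    next
      fix y z assume "y \<in> K" "z \<in> K"
      then obtain i j :: int where "y - of_int i * x \<in> H" "z - of_int j * x \<in> H"
        by (auto simp: K_def)
      from add_subgroup_diff[OF H this] have "(y - z) - of_int (i - j) * x \<in> H"
        by (simp add: algebra_simps)
      then show "y - z \<in> K" unfolding K_def by blast
    qed
    moreover have "x \<in> K"
      unfolding K_def using add_subgroup_zero[OF H] by (auto intro!: exI[of _ 1])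
    moreover have "H \<subseteq> K"
      unfolding K_def by (auto intro!: exI[of _ 0])
    ultimately have "K = UNIV"
      using max[of K] x by (auto simp: S_def)
    then show ?thesis unfolding K_def by blast
  qed
  define n where "n = (LEAST n. n > 0 \<and> of_nat n * x \<in> H)"
  \<comment> \<open>The characteristic witnesses that some positive multiple of \<open>x\<close> lies in \<open>H\<close>.\<close>
  have "CHAR('c) > 0" by (rule finite_imp_CHAR_pos) simp
  moreover have "of_nat (CHAR('c)) * x \<in> H" using add_subgroup_zero[OF H] by simp
  ultimately have n: "n > 0" "of_nat n * x \<in> H"
    using LeastI[of "\<lambda>n. n > 0 \<and> of_nat n * x \<in> H" "CHAR('c)"] unfolding n_def by simp_all
  have n_least: "k = 0" if "k < n" "of_nat k * x \<in> H" for k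
    using not_less_Least[of k "\<lambda>n. n > 0 \<and> of_nat n * x \<in> H"] that unfolding n_def by auto
  have "n \<noteq> 1" using n(2) x by auto
  have dvd: "int n dvd i" if "of_int i * x \<in> H" for i
  proof -
    have "of_int (i mod int n) * x = of_int i * x - of_int (i div int n) * (of_nat n * x)"
      using minus_div_mult_eq_mod[of i "int n"]
      by (metis (no_types, lifting) left_diff_distrib mult.assoc of_int_diff of_int_mult of_int_of_nat_eq)
    also have "\<dots> \<in> H"
      by (intro add_subgroup_diff[OF H] that add_subgroup_of_int_mult[OF H] n(2))
    finally have "of_nat (nat (i mod int n)) * x \<in> H"
      using n(1) by simp
    then have "nat (i mod int n) = 0"
      using n(1) by (intro n_least) (simp_all add: nat_less_iff)
    moreover have "i mod int n \<ge> 0" using n(1) by simp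
    ultimately show ?thesis by (simp add: dvd_eq_mod_eq_0)
  qed
  define idx :: "'c \<Rightarrow> int" where "idx y = (SOME i. y - of_int i * x \<in> H)" for y
  have idx: "y - of_int (idx y) * x \<in> H" for y
    unfolding idx_def by (rule someI_ex[OF gen])
  \<comment> \<open>The chosen index is arbitrary within its class modulo \<open>n\<close>; \<open>\<chi>\<close> depends on the class only.\<close>
  define \<chi> where "\<chi> y = cis (2 * pi * (of_int (idx y) / of_nat n))" for y
  have \<chi>: "\<chi> y = cis (2 * pi * (of_int i / of_nat n))" if "y - of_int i * x \<in> H" for y i
  proof -
    have "of_int (idx y - i) * x \<in> H"
      using add_subgroup_diff[OF H that idx[of y]] by (simp add: algebra_simps)
    then obtain t where t: "idx y = i + int n * t"
      using dvd by (metis add_diff_cancel_left' dvdE diff_add_cancel add.commute)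
    have "2 * pi * (of_int (idx y) / of_nat n) = 2 * pi * (of_int i / of_nat n) + 2 * pi * of_int t"
      using n(1) by (simp add: t field_simps)
    then show ?thesis
      unfolding \<chi>_def by (simp add: cis_mult[symmetric])
  qed
  have "additive_character \<chi>"
    unfolding additive_character_def
  proof (intro conjI allI)
    fix y z
    have "(y + z) - of_int (idx y + idx z) * x \<in> H"
      using add_subgroup_add[OF H idx[of y] idx[of z]] by (simp add: algebra_simps)
    from \<chi>[OF this] show "\<chi> (y + z) = \<chi> y * \<chi> z"
      by (simp add: \<chi>_def cis_mult algebra_simps add_divide_distrib)
  qed (simp add: \<chi>_def)
  moreover have "\<chi> x \<noteq> 1"
  proof
    assume "\<chi> x = 1"
    moreover have "\<chi> x = cis (2 * pi * (of_int 1 / of_nat n))"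
      by (rule \<chi>) (use add_subgroup_zero[OF H] in simp)
    ultimately have "cos (2 * pi * (1 / of_nat n)) = 1"
      by (metis cis.sel(1) of_int_1 one_complex.sel(1))
    then obtain t :: int where "2 * pi * (1 / of_nat n) = of_int t * 2 * pi"
      by (auto simp: cos_one_2pi_int)
    then have "real_of_int t * real n = 1"
      using n(1) by (simp add: field_simps)
    then have "t * int n = 1"
      by (metis of_int_1 of_int_eq_iff of_int_mult of_int_of_nat_eq)
    then show False using \<open>n \<noteq> 1\<close>
      by (metis dvd_triv_right int_one_le_iff_zero_less nat_dvd_1_iff_1 int_dvd_int_iff of_nat_1)
  qed
  ultimately show ?thesis by blast
qed

lemma sum_scaled_character:
  fixes \<chi>0 :: "'c::{field,finite} \<Rightarrow> complex"
  assumes "additive_character \<chi>0" "\<chi>0 u \<noteq> 1"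
  shows "(\<Sum>x\<in>UNIV. \<chi>0 (\<beta> * x)) = (if \<beta> = 0 then of_nat CARD('c) else 0)"
proof (cases "\<beta> = 0")
  case True
  then show ?thesis using additive_character_zero[OF assms(1)] by simp
next
  case False
  have "additive_character (\<lambda>x. \<chi>0 (\<beta> * x))"
    using assms(1) by (simp add: additive_character_def algebra_simps)
  moreover have "\<exists>x. \<chi>0 (\<beta> * x) \<noteq> 1"
    by (rule exI[of _ "u / \<beta>"]) (use assms(2) False in simp)
  ultimately show ?thesis
    using sum_character_over_subgroup[of "\<lambda>x. \<chi>0 (\<beta> * x)" UNIV] False
    by (auto simp: add_subgroup_def split: if_splits)
qed

text \<open>
  The field is self-dual: summing \<open>\<chi>(x) \<chi>\<^sub>0(-\<beta> x)\<close> over \<open>x\<close> and \<open>\<beta>\<close> leaves only the terms with \<open>x = 0\<close>, so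
  the total is not zero. Hence \<open>\<chi>\<close> is not orthogonal to every \<open>\<chi>\<^sub>0(\<beta> x)\<close>, and two characters that are
  not orthogonal are equal.
\<close>

lemma additive_character_eq_scaled:
  fixes \<chi>0 :: "'c::{field,finite} \<Rightarrow> complex"
  assumes \<chi>0: "additive_character \<chi>0" "\<chi>0 u \<noteq> 1" and \<chi>: "additive_character \<chi>"
  obtains \<beta> where "\<chi> = (\<lambda>x. \<chi>0 (\<beta> * x))"
proof -
  have "(\<Sum>\<beta>\<in>UNIV. \<Sum>x\<in>UNIV. \<chi> x * \<chi>0 (- \<beta> * x)) = (\<Sum>x\<in>UNIV. \<chi> x * (\<Sum>\<beta>\<in>UNIV. \<chi>0 (- x * \<beta>)))"
    by (subst sum.swap) (simp add: sum_distrib_left mult.commute)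
  also have "\<dots> = (\<Sum>x\<in>UNIV. if x = 0 then \<chi> x * of_nat CARD('c) else 0)"
    by (intro sum.cong refl) (simp only: sum_scaled_character[OF \<chi>0] neg_equal_0_iff_equal, simp)
  also have "\<dots> = of_nat CARD('c)"
    using additive_character_zero[OF \<chi>] by simp
  finally have "(\<Sum>\<beta>\<in>UNIV. \<Sum>x\<in>UNIV. \<chi> x * \<chi>0 (- \<beta> * x)) \<noteq> 0"
    by simp
  then obtain \<beta> where \<beta>: "(\<Sum>x\<in>UNIV. \<chi> x * \<chi>0 (- \<beta> * x)) \<noteq> 0"
    by (meson sum.not_neutral_contains_not_neutral)
  have "additive_character (\<lambda>x. \<chi> x * \<chi>0 (- \<beta> * x))"
    using \<chi> \<chi>0(1) unfolding additive_character_def distrib_left by (simp only: simp_thms) simp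
  from sum_character_over_subgroup[OF this, of UNIV] \<beta>
  have one: "\<chi> x * \<chi>0 (- \<beta> * x) = 1" for x
    by (auto simp: add_subgroup_def split: if_splits)
  have "\<chi> x = \<chi>0 (\<beta> * x)" for x
    using one[of x] additive_character_uminus[OF \<chi>0(1), of "\<beta> * x"] \<chi>0(1)
    by (simp add: additive_character_def field_simps)
  then show ?thesis using that by blast
qed

lemma finite_additive_characters:
  "finite {\<chi> :: 'c::{field,finite} \<Rightarrow> complex. additive_character \<chi>}"
proof -
  obtain \<chi>0 :: "'c \<Rightarrow> complex" and u where \<chi>0: "additive_character \<chi>0" "\<chi>0 u \<noteq> 1"
    using exists_nontrivial_additive_character by blast
  have "{\<chi> :: 'c \<Rightarrow> complex. additive_character \<chi>} \<subseteq> range (\<lambda>\<beta> x. \<chi>0 (\<beta> * x))"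
    using additive_character_eq_scaled[OF \<chi>0] by blast
  then show ?thesis by (rule finite_subset) simp
qed

text \<open>
  After identifying characters with field elements, the characters that are trivial on \<open>H\<close> become the
  orthogonal complement of \<open>H\<close> for the pairing \<open>(\<beta>, x) \<mapsto> \<chi>\<^sub>0(\<beta> x)\<close>. Summing the pairing over
  \<open>\<beta>\<close> and over \<open>x \<in> H\<close> in both orders shows that the sizes of a subgroup and its complement multiply to
  the size of the field. So taking complements twice gives \<open>H\<close> back, and the sum over the complement
  is nonzero exactly at the elements of \<open>H\<close>.
\<close>

lemma sum_characters_trivial_on_subgroup:
  fixes H :: "'c::{field,finite} set"
  assumes H: "add_subgroup H"
  shows "of_nat (card H) * (\<Sum>\<chi> | additive_character \<chi> \<and> (\<forall>h\<in>H. \<chi> h = 1). \<chi> \<alpha>)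
    = (if \<alpha> \<in> H then of_nat CARD('c) else 0)"
proof -
  obtain \<chi>0 :: "'c \<Rightarrow> complex" and u where \<chi>0: "additive_character \<chi>0" "\<chi>0 u \<noteq> 1"
    using exists_nontrivial_additive_character by blast
  have hom: "\<chi>0 (x + y) = \<chi>0 x * \<chi>0 y" "\<chi>0 x \<noteq> 0" for x y
    using \<chi>0(1) by (auto simp: additive_character_def)
  define dual where "dual \<beta> = (\<lambda>x. \<chi>0 (\<beta> * x))" for \<beta>
  have dual_char: "additive_character (dual \<beta>)" for \<beta>
    unfolding dual_def additive_character_def by (simp add: hom distrib_left)
  have "inj dual"
  proof (rule injI)
    fix \<beta> \<beta>' assume eq: "dual \<beta> = dual \<beta>'"
    have "\<chi>0 ((\<beta> - \<beta>') * x) = 1" for x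
      using fun_cong[OF eq, of x] hom(2)
      by (simp add: dual_def left_diff_distrib additive_character_diff[OF \<chi>0(1)])
    then show "\<beta> = \<beta>'"
      using sum_scaled_character[OF \<chi>0, of "\<beta> - \<beta>'"] by (auto split: if_splits)
  qed
  have range: "range dual = {\<chi>. additive_character \<chi>}"
    using dual_char additive_character_eq_scaled[OF \<chi>0] unfolding dual_def by blast
  define perp where "perp K = {\<beta>. \<forall>h\<in>K. \<chi>0 (\<beta> * h) = 1}" for K
  have perp: "add_subgroup (perp K)" for K
    unfolding perp_def add_subgroup_def
    by (simp add: left_diff_distrib additive_character_diff[OF \<chi>0(1)] additive_character_zero[OF \<chi>0(1)])
  have card: "card K * card (perp K) = CARD('c)" if K: "add_subgroup K" for K
  proof -
    have "(of_nat (card K * card (perp K)) :: complex) = (\<Sum>\<beta>\<in>UNIV. if \<beta> \<in> perp K then of_nat (card K) else 0)"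
      by (simp add: sum.If_cases mult.commute)
    also have "\<dots> = (\<Sum>\<beta>\<in>UNIV. \<Sum>h\<in>K. dual \<beta> h)"
      by (intro sum.cong refl, subst sum_character_over_subgroup[OF dual_char K])
        (simp add: perp_def dual_def)
    also have "\<dots> = (\<Sum>h\<in>K. \<Sum>\<beta>\<in>UNIV. \<chi>0 (h * \<beta>))"
      by (subst sum.swap) (simp add: dual_def mult.commute)
    also have "\<dots> = of_nat CARD('c)"
      using add_subgroup_zero[OF K] by (simp add: sum_scaled_character[OF \<chi>0])
    finally show ?thesis
      using of_nat_eq_iff by blast
  qed
  have perp_perp: "perp (perp H) = H"
  proof (rule sym, rule card_seteq)
    show "H \<subseteq> perp (perp H)" by (auto simp: perp_def mult.commute)
    have "card (perp H) * card (perp (perp H)) = card (perp H) * card H"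
      using card[OF H] card[OF perp, of H] by (simp add: mult.commute)
    moreover have "card (perp H) \<noteq> 0"
      using card[OF H] by (metis mult_0_right zero_less_card_finite less_irrefl)
    ultimately show "card (perp (perp H)) \<le> card H" by simp
  qed simp
  have "{\<chi>. additive_character \<chi> \<and> (\<forall>h\<in>H. \<chi> h = 1)} = dual ` perp H"
  proof -
    have "{\<chi>. additive_character \<chi> \<and> (\<forall>h\<in>H. \<chi> h = 1)} = {\<chi> \<in> range dual. \<forall>h\<in>H. \<chi> h = 1}"
      using range by auto
    also have "\<dots> = dual ` perp H" by (auto simp: perp_def dual_def)
    finally show ?thesis .
  qed
  then have "(\<Sum>\<chi> | additive_character \<chi> \<and> (\<forall>h\<in>H. \<chi> h = 1). \<chi> \<alpha>) = (\<Sum>\<beta>\<in>perp H. dual \<alpha> \<beta>)"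
    using inj_on_subset[OF \<open>inj dual\<close> subset_UNIV, of "perp H"]
    by (simp add: sum.reindex) (simp add: dual_def mult.commute)
  also have "\<dots> = (if \<alpha> \<in> perp (perp H) then of_nat (card (perp H)) else 0)"
    by (subst sum_character_over_subgroup[OF dual_char perp]) (simp add: perp_def dual_def)
  finally show ?thesis
    by (simp add: perp_perp card[OF H] flip: of_nat_mult)
qed

section \<open>Orders of elements and of characters\<close>

lemma monic_dvd_imp_eq:
  fixes d f :: "'c::field poly"
  assumes "d dvd f" "lead_coeff d = 1" "lead_coeff f = 1" "degree f \<le> degree d"
  shows "d = f"
proof -
  obtain r where r: "f = d * r" using assms(1) by auto
  with assms have "degree r = 0"
    by (metis degree_mult_eq le_antisym add_le_same_cancel1 leading_coeff_0_iff mult_eq_0_iff zero_neq_one le_zero_eq)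
  then obtain c where "r = [:c:]" by (metis degree_eq_zeroE)
  with r have "f = smult c d" by simp
  moreover from this have "c = 1" using assms(2,3) by (metis lead_coeff_smult mult.right_neutral)
  ultimately show ?thesis by simp
qed

lemma poly_ideal_generator:
  fixes I :: "'c::field poly set"
  assumes diff: "\<And>p r. p \<in> I \<Longrightarrow> r \<in> I \<Longrightarrow> p - r \<in> I"
    and mult: "\<And>p r. p \<in> I \<Longrightarrow> r * p \<in> I"
    and c: "c \<in> I" "c \<noteq> 0"
  obtains d where "lead_coeff d = 1" "\<And>l. l \<in> I \<longleftrightarrow> d dvd l"
proof -
  obtain e where e: "e \<in> I" "e \<noteq> 0" and min: "\<And>l. l \<in> I \<Longrightarrow> l \<noteq> 0 \<Longrightarrow> degree e \<le> degree l"
    using exists_least_iff[of "\<lambda>n. \<exists>l. l \<in> I \<and> l \<noteq> 0 \<and> degree l = n"] c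
    by (metis not_le)
  define d where "d = smult (inverse (lead_coeff e)) e"
  have "l \<in> I \<longleftrightarrow> d dvd l" for l
  proof
    assume l: "l \<in> I"
    have "l mod e = l - (l div e) * e" by (simp add: minus_div_mult_eq_mod)
    then have "l mod e \<in> I" using l e(1) diff mult by simp
    then have "l mod e = 0"
      using min[of "l mod e"] degree_mod_less[OF e(2), of l] by linarith
    then show "d dvd l" using e(2) by (simp add: d_def smult_dvd_iff mod_eq_0_iff_dvd)
  next
    assume "d dvd l"
    then have "e dvd l" using e(2) by (simp add: d_def smult_dvd_iff)
    then show "l \<in> I" using mult[OF e(1)] by (auto simp: dvd_def mult.commute)
  qed
  moreover have "lead_coeff d = 1" using e(2) by (simp add: d_def)
  ultimately show ?thesis using that by blast
qed

context finite_field_extension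
begin

lemma xm1_nonzero [simp]: "xm1 \<noteq> 0"
  using xm1_monic(2) by auto

lemma element_order:
  obtains d where "lead_coeff d = 1" "\<And>l. la l \<alpha> = 0 \<longleftrightarrow> d dvd l"
proof (rule poly_ideal_generator[of "{l. la l \<alpha> = 0}" xm1])
  fix p r assume "p \<in> {l. la l \<alpha> = 0}"
  then show "r * p \<in> {l. la l \<alpha> = 0}" by (simp add: lin_app_mult)
qed (auto simp: lin_app_diff)

text \<open>
  The polynomials that annihilate \<open>\<chi>\<close> form an ideal that contains \<open>x\<^sup>m - 1\<close>; the unique monic
  annihilator of least degree is its generator.
\<close>

lemma Fq_Order:
  assumes \<chi>: "additive_character \<chi>"
  shows lead_coeff_Fq_Order: "lead_coeff (Fq_Order emb \<chi>) = 1"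
    and Fq_Order_dvd_iff: "Fq_Order emb \<chi> dvd f \<longleftrightarrow> annihilates_char emb f \<chi>"
proof -
  let ?I = "{f. annihilates_char emb f \<chi>}"
  obtain d where d: "lead_coeff d = 1" "\<And>l. l \<in> ?I \<longleftrightarrow> d dvd l"
  proof (rule poly_ideal_generator[of ?I xm1])
    fix p r assume "p \<in> ?I" "r \<in> ?I"
    then show "p - r \<in> ?I"
      by (simp add: annihilates_char_def lin_app_diff additive_character_diff[OF \<chi>])
  next
    fix p r assume "p \<in> ?I"
    then show "r * p \<in> ?I"
      by (subst mult.commute) (simp add: annihilates_char_def lin_app_mult)
  qed (auto simp: annihilates_char_def additive_character_zero[OF \<chi>])
  have "Fq_Order emb \<chi> = d"
    unfolding Fq_Order_def
  proof (rule the_equality)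
    show "lead_coeff d = 1 \<and> annihilates_char emb d \<chi> \<and>
       (\<forall>f'. lead_coeff f' = 1 \<and> annihilates_char emb f' \<chi> \<longrightarrow> degree d \<le> degree f')"
      using d by (metis dvd_imp_degree_le dvd_refl leading_coeff_0_iff mem_Collect_eq zero_neq_one)
  next
    fix f assume "lead_coeff f = 1 \<and> annihilates_char emb f \<chi> \<and>
       (\<forall>f'. lead_coeff f' = 1 \<and> annihilates_char emb f' \<chi> \<longrightarrow> degree f \<le> degree f')"
    then show "f = d"
      using d monic_dvd_imp_eq[of d f] by (metis dvd_refl mem_Collect_eq)
  qed
  with d show "lead_coeff (Fq_Order emb \<chi>) = 1"
    "Fq_Order emb \<chi> dvd f \<longleftrightarrow> annihilates_char emb f \<chi>" by auto
qed

text \<open>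
  The Order of \<open>\<chi>\<close> divides \<open>c\<close> exactly if \<open>\<chi>\<close> is trivial on the image of \<open>c\<close>, which is the kernel of
  \<open>e\<close> and has index \<open>q\<^bsup>deg c\<^esup>\<close>.
\<close>

lemma sum_characters_Order_dvd:
  assumes ce: "xm1 = c * e"
  shows "(\<Sum>\<chi> | additive_character \<chi> \<and> Fq_Order emb \<chi> dvd c. \<chi> \<alpha>)
    = (if la e \<alpha> = 0 then of_nat (CARD('a) ^ degree c) else 0)"
proof -
  let ?H = "range (la c)"
  have nz: "c \<noteq> 0" "e \<noteq> 0" using ce xm1_nonzero by (metis mult_eq_0_iff)+
  then have deg: "m = degree e + degree c"
    using ce xm1_monic(1) by (simp add: degree_mult_eq)
  have "la c (x - y) = la c x - la c y" for x y
    using lin_app_add_right[of c "x - y" y] by simp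
  then have H: "add_subgroup ?H"
    unfolding add_subgroup_def by (metis (no_types, opaque_lifting) lin_app_0_right rangeE rangeI)
  have "{\<chi>. additive_character \<chi> \<and> Fq_Order emb \<chi> dvd c}
      = {\<chi>. additive_character \<chi> \<and> (\<forall>h\<in>?H. \<chi> h = 1)}"
    by (auto simp: Fq_Order_dvd_iff annihilates_char_def)
  then have "of_nat (CARD('a) ^ degree e) * (\<Sum>\<chi> | additive_character \<chi> \<and> Fq_Order emb \<chi> dvd c. \<chi> \<alpha>)
      = (if \<alpha> \<in> ?H then of_nat CARD('b) else 0)"
    using sum_characters_trivial_on_subgroup[OF H, of \<alpha>] range_lin_app(2)[OF ce] by simp
  also have "\<dots> = of_nat (CARD('a) ^ degree e) * (if la e \<alpha> = 0 then of_nat (CARD('a) ^ degree c) else 0)"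
    using range_lin_app(1)[OF ce] by (simp add: card_ext deg power_add)
  finally show ?thesis by simp
qed

end

section \<open>Normality and the order of an element\<close>

lemma smult_sum_right: "smult c (\<Sum>i\<in>A. f i) = (\<Sum>i\<in>A. smult c (f i))"
  by (induction A rule: infinite_finite_induct) (simp_all add: smult_add_right)

lemma lead_coeff_gcd:
  fixes p r :: "'c::field_gcd poly"
  assumes "p \<noteq> 0"
  shows "lead_coeff (gcd p r) = 1"
proof -
  have "gcd p r \<noteq> 0" using assms by simp
  then have "lead_coeff (normalize (gcd p r)) = 1"
    by (simp add: is_unit_normalize dvd_field_iff normalize_poly_eq_map_poly coeff_map_poly
        degree_map_poly del: normalize_gcd)
  then show ?thesis by simp
qed

context finite_field_extension
begin

abbreviation ext_xm1 :: "'b poly" where "ext_xm1 \<equiv> x_pow_minus_one m"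

lemma power_q_power_add_m: "(x :: 'b) ^ (CARD('a) ^ (n + m)) = x ^ (CARD('a) ^ n)"
  by (simp add: power_add power_mult mult.commute[of "CARD('a) ^ n"])

lemmas ext_xm1_monic = x_pow_minus_one_monic[OF m_pos, where 'c='b]

lemma x_times_normal_poly:
  "monom 1 1 * normal_poly CARD('a) m \<beta> = normal_poly CARD('a) m (\<beta> ^ CARD('a)) + smult \<beta> ext_xm1"
proof -
  obtain n where m: "m = Suc n" using m_pos by (cases m) auto
  have "monom 1 1 * normal_poly CARD('a) m \<beta> = (\<Sum>i<Suc n. monom (\<beta> ^ (CARD('a) ^ i)) (Suc (n - i)))"
    by (simp add: normal_poly_def m sum_distrib_left mult_monom del: sum.lessThan_Suc)
  also have "\<dots> = monom \<beta> m + (\<Sum>i<n. monom (\<beta> ^ (CARD('a) ^ Suc i)) (n - i))"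
    by (subst sum.lessThan_Suc_shift) (simp add: m Suc_diff_Suc)
  also have "(\<Sum>i<n. monom (\<beta> ^ (CARD('a) ^ Suc i)) (n - i)) = normal_poly CARD('a) m (\<beta> ^ CARD('a)) - monom \<beta> 0"
    using power_q_power_m[of \<beta>] by (simp add: normal_poly_def m power_mult[symmetric] mult.commute)
  finally show ?thesis
    by (simp add: x_pow_minus_one_def smult_diff_right smult_monom monom_0)
qed

lemma ext_xm1_dvd_monom_times_normal_poly:
  "ext_xm1 dvd monom 1 t * normal_poly CARD('a) m \<alpha> - normal_poly CARD('a) m (\<alpha> ^ (CARD('a) ^ t))"
proof (induction t)
  case 0
  then show ?case by (simp add: monom_0 flip: one_pCons)
next
  case (Suc t)
  have "monom 1 (Suc t) * normal_poly CARD('a) m \<alpha> - normal_poly CARD('a) m (\<alpha> ^ (CARD('a) ^ Suc t))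
    = monom 1 1 * (monom 1 t * normal_poly CARD('a) m \<alpha> - normal_poly CARD('a) m (\<alpha> ^ (CARD('a) ^ t)))
      + smult (\<alpha> ^ (CARD('a) ^ t)) ext_xm1"
    unfolding right_diff_distrib x_times_normal_poly
    by (simp add: mult_monom mult.assoc[symmetric] power_mult[symmetric] mult.commute)
  with Suc show ?case by (simp add: dvd_smult)
qed

text \<open>
  Modulo \<open>x\<^sup>m - 1\<close> the product \<open>L g\<^sub>\<alpha>\<close> is a combination of the polynomials \<open>g\<close> of \<open>\<alpha>\<close>, \<open>\<alpha>\<^sup>q\<close>, and so on;
  it has degree below \<open>m\<close>, and its coefficients are the sums on the right for \<open>j < m\<close>. The other \<open>j\<close>
  add nothing because the sums are periodic in \<open>j\<close>.
\<close>

lemma ext_xm1_dvd_times_normal_poly_iff: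
  "ext_xm1 dvd L * normal_poly CARD('a) m \<alpha> \<longleftrightarrow>
     (\<forall>j. (\<Sum>t\<le>degree L. coeff L t * \<alpha> ^ (CARD('a) ^ (j + t))) = 0)"
proof -
  define s where "s j = (\<Sum>t\<le>degree L. coeff L t * \<alpha> ^ (CARD('a) ^ (j + t)))" for j
  define R where "R = (\<Sum>t\<le>degree L. smult (coeff L t) (normal_poly CARD('a) m (\<alpha> ^ (CARD('a) ^ t))))"
  have "L * normal_poly CARD('a) m \<alpha> - R = (\<Sum>t\<le>degree L. smult (coeff L t) (monom 1 t * normal_poly CARD('a) m \<alpha> - normal_poly CARD('a) m (\<alpha> ^ (CARD('a) ^ t))))"
    unfolding R_def
    by (subst (1) poly_as_sum_of_monoms[of L, symmetric])
      (simp add: sum_distrib_right smult_diff_right sum_subtractf smult_monom flip: mult_smult_left)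
  also have "ext_xm1 dvd \<dots>"
    by (intro dvd_sum dvd_smult ext_xm1_dvd_monom_times_normal_poly)
  finally have "ext_xm1 dvd L * normal_poly CARD('a) m \<alpha> \<longleftrightarrow> ext_xm1 dvd R"
    by (metis dvd_diff_right_iff dvd_diff_left_iff dvd_diff diff_diff_eq2 add_diff_cancel_left')
  moreover have R: "R = (\<Sum>i<m. monom (s i) (m - 1 - i))"
  proof -
    have "R = (\<Sum>i<m. \<Sum>t\<le>degree L. monom (coeff L t * \<alpha> ^ (CARD('a) ^ (i + t))) (m - 1 - i))"
      unfolding R_def normal_poly_def smult_sum_right
      by (subst sum.swap) (simp add: smult_monom power_add power_mult[symmetric] mult.commute)
    then show ?thesis by (simp add: s_def monom_sum)
  qed
  have "degree R \<le> m - 1"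
    unfolding R by (rule degree_sum_le) (auto intro: order.trans[OF degree_monom_le])
  then have "ext_xm1 dvd R \<longleftrightarrow> R = 0"
    using m_pos ext_xm1_monic(1) by (metis dvd_0_right dvd_imp_degree_le le_diff_conv2 not_less_eq_eq plus_1_eq_Suc add.commute)
  moreover have "R = 0 \<longleftrightarrow> (\<forall>i<m. s i = 0)"
  proof
    assume "R = 0"
    show "\<forall>i<m. s i = 0"
    proof (intro allI impI)
      fix i assume "i < m"
      have "coeff R (m - 1 - i) = (\<Sum>j<m. if j = i then s j else 0)"
        unfolding R coeff_sum using \<open>i < m\<close> by (intro sum.cong) auto
      then show "s i = 0" using \<open>R = 0\<close> \<open>i < m\<close> by simp
    qed
  qed (simp add: R)
  moreover have "(\<forall>i<m. s i = 0) \<longleftrightarrow> (\<forall>i. s i = 0)"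
  proof (intro iffI allI)
    fix i assume *: "\<forall>i<m. s i = 0"
    show "s i = 0"
    proof (induction i rule: less_induct)
      case (less i)
      show ?case
      proof (cases "i < m")
        case False
        then have "s i = s (i - m)"
          unfolding s_def
        proof (intro sum.cong refl)
          fix t
          have "i - m + t + m = i + t" using False by simp
          then show "coeff L t * \<alpha> ^ (CARD('a) ^ (i + t)) = coeff L t * \<alpha> ^ (CARD('a) ^ (i - m + t))"
            using power_q_power_add_m[of \<alpha> "i - m + t"] by simp
        qed
        with less False m_pos show ?thesis by simp
      qed (use * in simp)
    qed
  qed simp
  ultimately show ?thesis unfolding s_def by simp
qed

text \<open>
  Call \<open>L\<close> good if \<open>x\<^sup>m - 1\<close> divides \<open>L g\<^sub>\<alpha>\<close>; the good polynomials are the multiples of the cofactor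
  \<open>M\<close> of the greatest common divisor. Raising the coefficients to the \<open>q\<close>-th power only shifts the
  index in the criterion for goodness, so the image of \<open>M\<close> is good too, hence equal to \<open>M\<close>, and \<open>M\<close> has
  coefficients in the small field. For such polynomials, good means annihilating \<open>\<alpha>\<close>. So \<open>d\<close>
  divides \<open>M\<close>, \<open>M\<close> divides \<open>d\<close>, and the degrees agree.
\<close>

lemma degree_gcd_normal_poly:
  assumes d: "\<And>l. la l \<alpha> = 0 \<longleftrightarrow> d dvd l" and "lead_coeff d = 1"
  shows "degree (gcd ext_xm1 (normal_poly CARD('a) m \<alpha>)) + degree d = m"
proof -
  define D where "D = gcd ext_xm1 (normal_poly CARD('a) m \<alpha>)"
  have "ext_xm1 \<noteq> 0" using ext_xm1_monic(2) by auto
  then have D: "D \<noteq> 0" "lead_coeff D = 1"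
    unfolding D_def by (simp, rule lead_coeff_gcd)
  obtain M where M: "ext_xm1 = D * M" unfolding D_def by (metis dvdE gcd_dvd1)
  obtain G where G: "normal_poly CARD('a) m \<alpha> = D * G" unfolding D_def by (metis dvdE gcd_dvd2)
  have "coprime M G"
  proof (rule gcd_coprime)
    show "gcd ext_xm1 (normal_poly CARD('a) m \<alpha>) \<noteq> 0" using D by (simp add: D_def)
    show "ext_xm1 = M * gcd ext_xm1 (normal_poly CARD('a) m \<alpha>)"
      using D_def M by (metis mult.commute)
    show "normal_poly CARD('a) m \<alpha> = G * gcd ext_xm1 (normal_poly CARD('a) m \<alpha>)"
      using D_def G by (metis mult.commute)
  qed
  have M_monic: "lead_coeff M = 1"
    using D ext_xm1_monic(2) unfolding M by (simp add: lead_coeff_mult)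
  then have "M \<noteq> 0" by auto
  define good where "good L \<longleftrightarrow> (\<forall>j. (\<Sum>t\<le>degree L. coeff L t * \<alpha> ^ (CARD('a) ^ (j + t))) = 0)"
    for L :: "'b poly"
  have good_iff: "good L \<longleftrightarrow> M dvd L" for L
  proof -
    have "good L \<longleftrightarrow> D * M dvd D * (L * G)"
      unfolding good_def ext_xm1_dvd_times_normal_poly_iff[symmetric] M G by (simp add: algebra_simps)
    also have "\<dots> \<longleftrightarrow> M dvd L"
      using D \<open>coprime M G\<close> by (simp add: coprime_dvd_mult_left_iff)
    finally show ?thesis .
  qed
  define \<sigma> :: "'b poly \<Rightarrow> 'b poly" where "\<sigma> = map_poly (\<lambda>y. y ^ CARD('a))"
  have \<sigma>_coeff: "coeff (\<sigma> L) t = coeff L t ^ CARD('a)" for L t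
    unfolding \<sigma>_def by (simp add: coeff_map_poly)
  have \<sigma>_degree: "degree (\<sigma> L) = degree L" for L
    unfolding \<sigma>_def by (rule degree_map_poly) simp
  have "good (\<sigma> M)"
    unfolding good_def
  proof
    fix j
    have "(\<Sum>t\<le>degree (\<sigma> M). coeff (\<sigma> M) t * \<alpha> ^ (CARD('a) ^ (j + t)))
        = (\<Sum>t\<le>degree M. coeff M t * \<alpha> ^ (CARD('a) ^ (j + (m - 1) + t))) ^ (CARD('a) ^ 1)"
      \<comment> \<open>The index \<open>j - 1\<close>, shifted by a full period to stay a natural number.\<close>
      unfolding power_q_power_sum \<sigma>_degree
    proof (intro sum.cong refl)
      fix t
      have "(\<alpha> ^ (CARD('a) ^ (j + (m - 1) + t))) ^ CARD('a) = \<alpha> ^ (CARD('a) ^ Suc (j + (m - 1) + t))"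
        by (simp add: power_mult[symmetric] mult.commute)
      also have "Suc (j + (m - 1) + t) = (j + t) + m" using m_pos by simp
      finally show "coeff (\<sigma> M) t * \<alpha> ^ (CARD('a) ^ (j + t))
          = (coeff M t * \<alpha> ^ (CARD('a) ^ (j + (m - 1) + t))) ^ (CARD('a) ^ 1)"
        by (simp add: \<sigma>_coeff power_mult_distrib power_q_power_add_m)
    qed
    also have "\<dots> = 0"
      using good_iff[of M] by (simp add: good_def)
    finally show "(\<Sum>t\<le>degree (\<sigma> M). coeff (\<sigma> M) t * \<alpha> ^ (CARD('a) ^ (j + t))) = 0" .
  qed
  then have "M = \<sigma> M"
    using good_iff M_monic by (intro monic_dvd_imp_eq) (simp_all add: \<sigma>_degree \<sigma>_coeff)
  then have coeff_range: "coeff M t \<in> range emb" for t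
    using \<sigma>_coeff[of M t] by (simp add: power_q_eq_self_iff[symmetric])
  have good_emb: "good (map_poly emb l) \<longleftrightarrow> la l \<alpha> = 0" for l
  proof -
    have "(\<Sum>t\<le>degree (map_poly emb l). coeff (map_poly emb l) t * \<alpha> ^ (CARD('a) ^ (j + t)))
        = (la l \<alpha>) ^ (CARD('a) ^ j)" for j
      unfolding lin_app_def power_q_power_sum
      by (simp add: degree_map_poly coeff_map_poly power_mult_distrib power_add power_mult[symmetric] mult.commute)
    then show ?thesis by (simp add: good_def) 
  qed
  define M0 where "M0 = map_poly (inv emb) M"
  have inv0: "inv emb 0 = 0" using inv_f_f[OF inj_emb, of 0] by simp
  have "coeff (map_poly emb M0) t = coeff M t" for t
    using coeff_range[of t] by (simp add: M0_def coeff_map_poly inv0 f_inv_into_f)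
  then have M0: "map_poly emb M0 = M" by (simp add: poly_eq_iff)
  then have deg_M0: "degree M0 = degree M"
    by (metis degree_map_poly emb_eq_0_iff)
  have "d dvd M0" using d good_emb good_iff M0 by (metis dvd_refl)
  then have "degree d \<le> degree M"
    using deg_M0 M0 \<open>M \<noteq> 0\<close> by (metis dvd_imp_degree_le map_poly_0)
  moreover have "degree M \<le> degree d"
  proof -
    have "M dvd map_poly emb d" using d good_emb good_iff by (metis dvd_refl)
    moreover have "degree (map_poly emb d) = degree d" by (simp add: degree_map_poly)
    moreover have "map_poly emb d \<noteq> 0"
      using assms(2) by (metis coeff_map_poly emb_eq_0_iff emb_zero coeff_0 zero_neq_one)
    ultimately show ?thesis by (metis dvd_imp_degree_le)
  qed
  moreover have "degree D + degree M = m"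
    using M D \<open>M \<noteq> 0\<close> ext_xm1_monic(1) by (metis degree_mult_eq)
  ultimately show ?thesis by (simp add: D_def)
qed

end

section \<open>Sets of prime polynomials and the functions \<open>\<phi>\<close> and \<open>\<mu>\<close>\<close>

lemma prime_poly_iff: "prime (p :: 'c::field_gcd poly) \<longleftrightarrow> irreducible p \<and> lead_coeff p = 1"
proof (cases "p = 0")
  case False
  have "normalize p = p \<longleftrightarrow> lead_coeff p = 1"
  proof
    assume "normalize p = p"
    then show "lead_coeff p = 1" using lead_coeff_gcd[of p 0] False by simp
  qed (simp add: normalize_poly_eq_map_poly)
  then show ?thesis
    using irreducible_imp_prime_elem[of p] prime_elem_imp_irreducible[of p] by (auto simp: prime_def)
qed simp

lemma lead_coeff_prod_primes:
  fixes A :: "'c::field_gcd poly set"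
  assumes "\<And>p. p \<in> A \<Longrightarrow> prime p"
  shows "lead_coeff (\<Prod>A) = 1"
proof -
  have "lead_coeff (\<Prod>A) = (\<Prod>p\<in>A. lead_coeff p)" by (simp add: lead_coeff_prod)
  also have "\<dots> = 1" using assms by (intro prod.neutral) (simp add: prime_poly_iff)
  finally show ?thesis .
qed

lemma prod_primes_nonzero:
  fixes A :: "'c::field_gcd poly set"
  assumes "\<And>p. p \<in> A \<Longrightarrow> prime p"
  shows "\<Prod>A \<noteq> 0"
proof -
  have "lead_coeff (\<Prod>A) = 1" using assms by (rule lead_coeff_prod_primes)
  then show ?thesis by auto
qed

lemma prod_primes_dvd_iff:
  fixes A :: "'c::field_gcd poly set"
  assumes "finite A" "\<And>p. p \<in> A \<Longrightarrow> prime p"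
  shows "\<Prod>A dvd r \<longleftrightarrow> (\<forall>p\<in>A. p dvd r)"
  using assms
proof (induction A rule: finite_induct)
  case (insert p A)
  have "coprime p (\<Prod>A)"
    by (rule prod_coprime_right) (metis insert.hyps(2) insert.prems insertCI primes_coprime)
  with insert show ?case
    by (auto simp: intro: divides_mult dvd_mult_left dvd_mult_right)
qed simp

lemma prime_dvd_prod_primes_iff:
  fixes A :: "'c::field_gcd poly set"
  assumes "finite A" "\<And>p. p \<in> A \<Longrightarrow> prime p" "prime p"
  shows "p dvd \<Prod>A \<longleftrightarrow> p \<in> A"
  unfolding prime_dvd_prod_iff[OF assms(1,3)]
  using assms(2,3) by (metis dvd_refl primes_dvd_imp_eq)

lemma prime_factors_prod_primes:
  fixes A :: "'c::field_gcd poly set"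
  assumes "finite A" "\<And>p. p \<in> A \<Longrightarrow> prime p"
  shows "prime_factors (\<Prod>A) = A"
proof -
  have "\<Prod>A \<noteq> 0" using assms(2) by (rule prod_primes_nonzero)
  then show ?thesis
    using assms prime_dvd_prod_primes_iff[OF assms] by (auto simp: in_prime_factors_iff)
qed

lemma distinct_irreducible_factors_prod_primes_iff:
  assumes "finite A" "\<And>p. p \<in> A \<Longrightarrow> prime p"
  shows "distinct_irreducible_factors (\<Prod>A) P \<longleftrightarrow> P = A"
proof
  assume P: "distinct_irreducible_factors (\<Prod>A) P"
  then have P': "finite P" "\<And>p. p \<in> P \<Longrightarrow> prime p"
    by (auto simp: distinct_irreducible_factors_def prime_poly_iff)
  have "lead_coeff (\<Prod>A) = 1" using assms(2) by (rule lead_coeff_prod_primes)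
  moreover have "\<Prod>A = smult (lead_coeff (\<Prod>A)) (\<Prod>P)"
    using P unfolding distinct_irreducible_factors_def by blast
  ultimately have "\<Prod>A = \<Prod>P" by (simp only: smult_1_left)
  then have "prime_factors (\<Prod>P) = A"
    using prime_factors_prod_primes[OF assms] by (simp only:)
  then show "P = A"
    using prime_factors_prod_primes[OF P'] by (simp only:)
next
  assume "P = A"
  have "lead_coeff (\<Prod>A) = 1" using assms(2) by (rule lead_coeff_prod_primes)
  then show "distinct_irreducible_factors (\<Prod>A) P"
    unfolding \<open>P = A\<close> distinct_irreducible_factors_def prime_poly_iff[symmetric]
    using assms by simp
qed

lemma poly_mu_prod_primes:
  assumes "finite A" "\<And>p. p \<in> A \<Longrightarrow> prime p"
  shows "poly_mu (\<Prod>A) = (- 1) ^ card A"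
proof -
  have "\<Prod>A \<noteq> 0" using assms(2) by (rule prod_primes_nonzero)
  moreover have "(THE P. distinct_irreducible_factors (\<Prod>A) P) = A"
    by (rule the_equality) (simp_all only: distinct_irreducible_factors_prod_primes_iff[OF assms])
  moreover have "\<exists>P. distinct_irreducible_factors (\<Prod>A) P"
    using distinct_irreducible_factors_prod_primes_iff[OF assms] by blast
  ultimately show ?thesis
    by (simp add: poly_mu_def)
qed

lemma card_polys_degree_less:
  "finite {p :: 'c::{comm_semiring_1,finite} poly. p = 0 \<or> degree p < n}" (is "?fin n")
  "card {p :: 'c poly. p = 0 \<or> degree p < n} = CARD('c) ^ n" (is "?card n")
proof -
  have "?fin n \<and> ?card n"
  proof (induction n)
    case (Suc n)
    let ?S = "\<lambda>n. {p :: 'c poly. p = 0 \<or> degree p < n}"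
    have S: "?S (Suc n) = (\<lambda>(a, p). pCons a p) ` (UNIV \<times> ?S n)"
    proof (intro equalityI subsetI)
      fix p assume "p \<in> ?S (Suc n)"
      then show "p \<in> (\<lambda>(a, p). pCons a p) ` (UNIV \<times> ?S n)"
        by (cases p) (auto simp: image_iff split: if_splits)
    qed (auto split: if_splits)
    have "inj_on (\<lambda>(a, p). pCons a p) (UNIV \<times> ?S n)" by (auto simp: inj_on_def)
    with Suc show ?case unfolding S by (simp add: card_image card_cartesian_product)
  qed simp
  then show "?fin n" "?card n" by auto
qed

lemma finite_monic_divisors:
  fixes f :: "'a::{field_gcd,finite} poly"
  assumes "f \<noteq> 0"
  shows "finite (monic_divisors f)"
proof (rule finite_subset[OF _ card_polys_degree_less(1)[of "Suc (degree f)"]])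
  show "monic_divisors f \<subseteq> {p. p = 0 \<or> degree p < Suc (degree f)}"
    using assms by (auto simp: monic_divisors_def less_Suc_eq_le dest: dvd_imp_degree_le)
qed

text \<open>
  The monic squarefree divisors of \<open>f\<close> correspond to the sets of prime divisors of \<open>f\<close>; all other
  divisors have \<open>\<mu> = 0\<close>.
\<close>

lemma sum_poly_mu_times:
  fixes F :: "'a::{field_gcd,finite} poly \<Rightarrow> complex"
  assumes "f \<noteq> 0"
  shows "(\<Sum>h\<in>monic_divisors f. of_int (poly_mu h) * F h)
    = (\<Sum>A\<in>Pow (prime_factors f). (- 1) ^ card A * F (\<Prod>A))"
proof -
  have prime: "prime p" if "p \<in> A" "A \<in> Pow (prime_factors f)" for p A
    using that by auto
  have fin: "finite A" if "A \<in> Pow (prime_factors f)" for A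
    using that by (auto intro: finite_subset)
  have "(\<Sum>A\<in>Pow (prime_factors f). (- 1) ^ card A * F (\<Prod>A))
      = (\<Sum>A\<in>Pow (prime_factors f). of_int (poly_mu (\<Prod>A)) * F (\<Prod>A))"
    by (intro sum.cong refl, subst poly_mu_prod_primes) (use fin prime in auto)
  also have "\<dots> = (\<Sum>h\<in>Prod ` Pow (prime_factors f). of_int (poly_mu h) * F h)"
  proof (rule sum.reindex_cong[symmetric, OF _ refl])
    show "inj_on Prod (Pow (prime_factors f))"
      by (rule inj_onI) (metis fin prime prime_factors_prod_primes)
  qed simp
  also have "\<dots> = (\<Sum>h\<in>monic_divisors f. of_int (poly_mu h) * F h)"
  proof (rule sum.mono_neutral_left)
    show "Prod ` Pow (prime_factors f) \<subseteq> monic_divisors f"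
    proof safe
      fix A assume A: "A \<subseteq> prime_factors f"
      then have "\<Prod>A dvd f"
        by (subst prod_primes_dvd_iff) (use fin in auto)
      moreover have "lead_coeff (\<Prod>A) = 1"
        by (rule lead_coeff_prod_primes) (use A in auto)
      ultimately show "\<Prod>A \<in> monic_divisors f" by (simp add: monic_divisors_def)
    qed
    show "\<forall>h\<in>monic_divisors f - Prod ` Pow (prime_factors f). of_int (poly_mu h) * F h = 0"
    proof
      fix h assume h: "h \<in> monic_divisors f - Prod ` Pow (prime_factors f)"
      have "\<not> distinct_irreducible_factors h P" for P
      proof
        assume "distinct_irreducible_factors h P"
        then have P: "finite P" "\<And>p. p \<in> P \<Longrightarrow> prime p" "h = \<Prod>P"
          using h by (auto simp: distinct_irreducible_factors_def prime_poly_iff monic_divisors_def)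
        have "h dvd f" using h by (simp add: monic_divisors_def)
        with P assms have "P \<subseteq> prime_factors f"
          using prod_primes_dvd_iff[OF P(1,2)] by (auto simp: in_prime_factors_iff)
        then show False using h P(3) by blast
      qed
      then show "of_int (poly_mu h) * F h = 0" by (simp add: poly_mu_def)
    qed
  qed (rule finite_monic_divisors[OF assms])
  finally show ?thesis by simp
qed

lemma card_multiples_degree_less:
  fixes u :: "'c::{field,finite} poly"
  assumes "u \<noteq> 0" "degree u \<le> n"
  shows "card {r. (r = 0 \<or> degree r < n) \<and> u dvd r} = CARD('c) ^ (n - degree u)"
proof -
  have "u * s = 0 \<or> degree (u * s) < n \<longleftrightarrow> s = 0 \<or> degree s < n - degree u" for s
    using assms by (cases "s = 0") (simp_all add: degree_mult_eq less_diff_conv add.commute)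
  moreover have "{r. (r = 0 \<or> degree r < n) \<and> u dvd r} = (*) u ` {s. u * s = 0 \<or> degree (u * s) < n}"
    by (auto simp: dvd_def simp del: mult_eq_0_iff)
  ultimately have "{r. (r = 0 \<or> degree r < n) \<and> u dvd r} = (*) u ` {s. s = 0 \<or> degree s < n - degree u}"
    by simp
  moreover have "inj_on ((*) u) {s. s = 0 \<or> degree s < n - degree u}"
    using assms(1) by (simp add: inj_on_def)
  ultimately show ?thesis by (simp add: card_image card_polys_degree_less)
qed

lemma power_degree_prod_primes:
  fixes A :: "'c::field_gcd poly set"
  assumes "\<And>p. p \<in> A \<Longrightarrow> prime p"
  shows "(x :: 'd::comm_semiring_1) ^ degree (\<Prod>A) = (\<Prod>p\<in>A. x ^ degree p)"
proof -
  have "degree (\<Prod>A) = (\<Sum>p\<in>A. degree p)"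
    by (rule degree_prod_eq_sum_degree) (use assms not_prime_0 in blast)
  then show ?thesis by (simp add: power_sum)
qed

text \<open>
  The number of residues modulo \<open>p\<close>, as a complex number: the absolute norm of \<open>p\<close>.
\<close>

abbreviation residue_count :: "'a::{field_gcd,finite} poly \<Rightarrow> complex"
  where "residue_count p \<equiv> of_nat (CARD('a) ^ degree p)"

lemma card_power_degree_prime_gt_1:
  fixes p :: "'a::{field_gcd,finite} poly"
  assumes "prime p"
  shows "CARD('a) ^ degree p > 1"
proof -
  have "degree p \<noteq> 0"
    using assms by (metis is_unit_iff_degree not_prime_unit not_prime_0)
  then show ?thesis using card_ge_2[where 'c='a] by (intro one_less_power) linarith+
qed

lemma prod_of_bool: "finite A \<Longrightarrow> (\<Prod>x\<in>A. of_bool (R x)) = (of_bool (\<forall>x\<in>A. R x) :: 'c::comm_semiring_1)"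
  by (induction A rule: finite_induct) auto

text \<open>
  Inclusion and exclusion over the prime divisors of \<open>f\<close>: below the degree of \<open>f\<close>, a divisor \<open>u\<close> of \<open>f\<close>
  has exactly \<open>q\<^bsup>deg f - deg u\<^esup>\<close> multiples.
\<close>

lemma poly_phi_eq:
  fixes f :: "'a::{field_gcd,finite} poly"
  assumes "f \<noteq> 0"
  shows "of_nat (poly_phi f) = residue_count f * (\<Prod>p\<in>prime_factors f. 1 - 1 / residue_count p)"
proof -
  let ?S = "{r :: 'a poly. r = 0 \<or> degree r < degree f}"
  let ?P = "prime_factors f"
  have S: "finite ?S" by (rule card_polys_degree_less)
  have coprime: "of_bool (coprime r f) = (\<Sum>U\<in>Pow ?P. (- 1) ^ card U * (of_bool (\<Prod>U dvd r) :: complex))" for r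
  proof -
    have "coprime r f \<longleftrightarrow> (\<forall>p\<in>?P. \<not> p dvd r)"
    proof
      assume "coprime r f"
      then show "\<forall>p\<in>?P. \<not> p dvd r"
        by (metis coprime_common_divisor in_prime_factors_iff not_prime_unit)
    next
      assume *: "\<forall>p\<in>?P. \<not> p dvd r"
      show "coprime r f"
      proof (rule ccontr)
        assume "\<not> coprime r f"
        then have "gcd r f \<noteq> 0" "\<not> is_unit (gcd r f)" using assms by (auto simp: is_unit_gcd)
        then obtain p where "prime p" "p dvd gcd r f" using prime_divisor_exists by blast
        with * assms show False by (auto simp: in_prime_factors_iff)
      qed
    qed
    then have "of_bool (coprime r f) = (\<Prod>p\<in>?P. of_bool (\<not> p dvd r) :: complex)"
      by (simp add: prod_of_bool)
    also have "\<dots> = (\<Prod>p\<in>?P. 1 - of_bool (p dvd r))"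
      by (simp add: of_bool_not_iff)
    also have "\<dots> = (\<Sum>U\<in>Pow ?P. (- 1) ^ card U * (\<Prod>p\<in>U. of_bool (p dvd r)) * (\<Prod>p\<in>?P - U. 1))"
      by (rule prod_diff_conv_sum) simp
    also have "\<dots> = (\<Sum>U\<in>Pow ?P. (- 1) ^ card U * of_bool (\<Prod>U dvd r))"
    proof (intro sum.cong refl)
      fix U assume U: "U \<in> Pow ?P"
      then have "finite U" "\<And>p. p \<in> U \<Longrightarrow> prime p" by (auto intro: finite_subset)
      then show "(- 1) ^ card U * (\<Prod>p\<in>U. of_bool (p dvd r)) * (\<Prod>p\<in>?P - U. 1)
          = (- 1) ^ card U * (of_bool (\<Prod>U dvd r) :: complex)"
        by (simp add: prod_of_bool prod_primes_dvd_iff)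
    qed
    finally show ?thesis .
  qed
  have "of_nat (poly_phi f) = (\<Sum>r\<in>?S. of_bool (coprime r f) :: complex)"
    unfolding poly_phi_def using S by (simp add: sum.If_cases of_bool_def Int_def)
  also have "\<dots> = (\<Sum>U\<in>Pow ?P. (- 1) ^ card U * (\<Sum>r\<in>?S. of_bool (\<Prod>U dvd r)))"
    unfolding coprime by (subst sum.swap) (simp add: sum_distrib_left)
  also have "\<dots> = (\<Sum>U\<in>Pow ?P. residue_count f * ((- 1) ^ card U * (\<Prod>p\<in>U. 1 / residue_count p) * (\<Prod>p\<in>?P - U. 1)))"
  proof (intro sum.cong refl)
    fix U assume U: "U \<in> Pow ?P"
    then have U': "finite U" "\<And>p. p \<in> U \<Longrightarrow> prime p" by (auto intro: finite_subset)
    have "\<Prod>U dvd f" using U by (subst prod_primes_dvd_iff[OF U']) auto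
    then have deg: "degree (\<Prod>U) \<le> degree f" using assms by (rule dvd_imp_degree_le)
    have nz: "\<Prod>U \<noteq> 0" using U'(2) by (rule prod_primes_nonzero)
    have "(\<Sum>r\<in>?S. of_bool (\<Prod>U dvd r) :: complex) = of_nat (card {r. (r = 0 \<or> degree r < degree f) \<and> \<Prod>U dvd r})"
      using S by (simp add: sum.If_cases of_bool_def Int_def)
    also have "\<dots> = of_nat (CARD('a) ^ (degree f - degree (\<Prod>U)))"
      by (simp only: card_multiples_degree_less[OF nz deg])
    also have "\<dots> = residue_count f / residue_count (\<Prod>U)"
      unfolding of_nat_power using deg by (intro power_diff) simp_all
    also have "\<dots> = residue_count f * (\<Prod>p\<in>U. 1 / residue_count p)"
      by (simp add: power_degree_prod_primes[OF U'(2)] prod_dividef)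
    finally show "(- 1) ^ card U * (\<Sum>r\<in>?S. of_bool (\<Prod>U dvd r)) =
        residue_count f * ((- 1) ^ card U * (\<Prod>p\<in>U. 1 / residue_count p) * (\<Prod>p\<in>?P - U. 1))"
      by simp
  qed
  also have "\<dots> = residue_count f * (\<Prod>p\<in>?P. 1 - 1 / residue_count p)"
    by (subst prod_diff_conv_sum) (simp_all add: sum_distrib_left)
  finally show ?thesis .
qed

lemma poly_phi_prod_primes:
  fixes A :: "'a::{field_gcd,finite} poly set"
  assumes "finite A" "\<And>p. p \<in> A \<Longrightarrow> prime p"
  shows "of_nat (poly_phi (\<Prod>A)) = (\<Prod>p\<in>A. residue_count p - 1)"
proof -
  have "\<Prod>A \<noteq> 0" using assms(2) by (rule prod_primes_nonzero)
  then have "of_nat (poly_phi (\<Prod>A)) = residue_count (\<Prod>A) * (\<Prod>p\<in>A. 1 - 1 / residue_count p)"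
    using poly_phi_eq[of "\<Prod>A"] by (simp only: prime_factors_prod_primes[OF assms] simp_thms)
  also have "\<dots> = (\<Prod>p\<in>A. residue_count p * (1 - 1 / residue_count p))"
    by (simp add: power_degree_prod_primes[OF assms(2)] prod.distrib)
  also have "\<dots> = (\<Prod>p\<in>A. residue_count p - 1)"
    by (intro prod.cong refl) (simp add: algebra_simps)
  finally show ?thesis .
qed

section \<open>Inclusion and exclusion over prime divisors\<close>

text \<open>
  Dividing out \<open>c\<close>, all divisibility conditions on \<open>c\<close> become conditions on the single complementary
  divisor \<open>w\<close>.
\<close>

lemma dvd_times_prod_Diff_iff:
  fixes A :: "'c::field_gcd poly set"
  assumes A: "finite A" "\<And>p. p \<in> A \<Longrightarrow> prime p" and "W \<subseteq> A" "c \<noteq> 0" and w: "e * \<Prod>A = c * w"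
  shows "c dvd e * \<Prod>(A - W) \<longleftrightarrow> \<Prod>W dvd w"
proof -
  have nz: "\<Prod>W \<noteq> 0" by (rule prod_primes_nonzero) (use assms(2,3) in auto)
  have "\<Prod>A = \<Prod>(A - W) * \<Prod>W" using A(1) \<open>W \<subseteq> A\<close> by (rule prod.subset_diff[rotated])
  then have "c dvd e * \<Prod>(A - W) \<longleftrightarrow> \<Prod>W * c dvd c * w"
    using nz unfolding w[symmetric] by (simp add: mult.commute mult.left_commute)
  also have "\<dots> \<longleftrightarrow> \<Prod>W dvd w"
    using \<open>c \<noteq> 0\<close> by (simp add: mult.commute)
  finally show ?thesis .
qed

text \<open>
  If \<open>w\<close> is the complementary divisor of \<open>c\<close> in \<open>e \<Prod>A\<close>, then \<open>c = g \<Prod>A\<close> means \<open>g w = e\<close>. So the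
  condition on the left says that \<open>w\<close> is a divisor of \<open>e\<close> coprime to \<open>\<Prod>A\<close>; since \<open>w\<close> divides \<open>e \<Prod>A\<close>,
  coprimality alone already forces \<open>w\<close> to divide \<open>e\<close>. The right side says that no \<open>p \<in> A\<close> divides \<open>w\<close>.
\<close>

lemma order_factorisation_iff:
  fixes A :: "'a::{field_gcd,finite} poly set"
  assumes A: "finite A" "\<And>p. p \<in> A \<Longrightarrow> prime p" and e: "lead_coeff e = 1" and c: "lead_coeff c = 1"
  shows "(\<exists>g\<in>{g \<in> monic_divisors e. gcd (\<Prod>A) (e div g) = 1}. c = \<Prod>A * g)
    \<longleftrightarrow> c dvd e * \<Prod>A \<and> (\<forall>p\<in>A. \<not> c dvd e * \<Prod>(A - {p}))"
proof -
  have cnz: "c \<noteq> 0" and enz: "e \<noteq> 0" using c e by auto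
  have h: "lead_coeff (\<Prod>A) = 1" by (rule lead_coeff_prod_primes) (rule A(2))
  then have hnz: "\<Prod>A \<noteq> 0" by auto
  have coprime_iff: "gcd (\<Prod>A) w = 1 \<longleftrightarrow> (\<forall>p\<in>A. \<not> p dvd w)" for w
  proof
    assume "gcd (\<Prod>A) w = 1"
    then show "\<forall>p\<in>A. \<not> p dvd w"
      using A by (metis coprime_common_divisor coprime_iff_gcd_eq_1 dvd_prodI not_prime_unit)
  next
    assume *: "\<forall>p\<in>A. \<not> p dvd w"
    have "coprime (\<Prod>A) w"
      by (rule prod_coprime_left) (use * A(2) in \<open>simp add: prime_imp_coprime\<close>)
    then show "gcd (\<Prod>A) w = 1" by simp
  qed
  show ?thesis
  proof (cases "c dvd e * \<Prod>A")
    case True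
    then obtain w where w: "e * \<Prod>A = c * w" by auto
    have "(\<exists>g\<in>{g \<in> monic_divisors e. gcd (\<Prod>A) (e div g) = 1}. c = \<Prod>A * g) \<longleftrightarrow> (\<forall>p\<in>A. \<not> p dvd w)"
    proof
      assume "\<exists>g\<in>{g \<in> monic_divisors e. gcd (\<Prod>A) (e div g) = 1}. c = \<Prod>A * g"
      then obtain g where g: "g dvd e" "gcd (\<Prod>A) (e div g) = 1" "c = \<Prod>A * g"
        by (auto simp: monic_divisors_def)
      from w g(3) hnz have "e = g * w" by (simp add: mult.commute mult.left_commute)
      moreover have "g \<noteq> 0" using g(3) cnz by auto
      ultimately have "e div g = w" by simp
      with g(2) show "\<forall>p\<in>A. \<not> p dvd w" by (simp add: coprime_iff)
    next
      assume *: "\<forall>p\<in>A. \<not> p dvd w"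
      then have "coprime w (\<Prod>A)" using coprime_iff[of w] by (simp add: coprime_iff_gcd_eq_1 gcd.commute)
      moreover have "w dvd e * \<Prod>A" using w by simp
      ultimately have "w dvd e" by (simp add: coprime_dvd_mult_left_iff)
      then obtain g where g: "e = w * g" by auto
      have wnz: "w \<noteq> 0" "g \<noteq> 0" using g enz by auto
      have cg: "c = \<Prod>A * g"
        using w g wnz by (simp add: mult.commute mult.left_commute)
      then have "lead_coeff g = 1" using c h by (metis lead_coeff_mult mult_1)
      moreover have "e div g = w" unfolding g using wnz(2) by (rule nonzero_mult_div_cancel_right)
      then have "gcd (\<Prod>A) (e div g) = 1" using * coprime_iff[of w] by (simp only:)
      moreover have "g dvd e" unfolding g by (rule dvd_triv_right)
      ultimately have "g \<in> {g \<in> monic_divisors e. gcd (\<Prod>A) (e div g) = 1}"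
        unfolding monic_divisors_def by (intro CollectI conjI)
      with cg show "\<exists>g\<in>{g \<in> monic_divisors e. gcd (\<Prod>A) (e div g) = 1}. c = \<Prod>A * g" by (rule bexI)
    qed
    moreover have "c dvd e * \<Prod>(A - {p}) \<longleftrightarrow> p dvd w" if "p \<in> A" for p
      using dvd_times_prod_Diff_iff[OF A _ cnz w, of "{p}"] that by simp
    ultimately show ?thesis using True by simp
  qed (auto simp: monic_divisors_def mult.commute)
qed

text \<open>
  Expanding the product of the negated conditions gives a sum over the subsets \<open>W\<close> of \<open>A\<close>, and the
  conditions for all \<open>p \<in> W\<close> together mean that \<open>c\<close> divides \<open>e \<Prod>(A - W)\<close>. The sum is then written in
  terms of \<open>U = A - W\<close>.
\<close>

lemma of_bool_order_factorisation:
  fixes A :: "'c::field_gcd poly set"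
  assumes A: "finite A" "\<And>p. p \<in> A \<Longrightarrow> prime p" and "c \<noteq> 0"
  shows "of_bool (c dvd e * \<Prod>A \<and> (\<forall>p\<in>A. \<not> c dvd e * \<Prod>(A - {p})))
    = (\<Sum>U\<in>Pow A. (- 1) ^ (card A - card U) * (of_bool (c dvd e * \<Prod>U) :: complex))"
proof -
  have inter: "c dvd e * \<Prod>(A - W) \<longleftrightarrow> c dvd e * \<Prod>A \<and> (\<forall>p\<in>W. c dvd e * \<Prod>(A - {p}))"
    if W: "W \<subseteq> A" for W
  proof (cases "c dvd e * \<Prod>A")
    case True
    then obtain w where w: "e * \<Prod>A = c * w" by auto
    have "finite W" "\<And>p. p \<in> W \<Longrightarrow> prime p" using W A by (auto intro: finite_subset)
    then show ?thesis
      using W True dvd_times_prod_Diff_iff[OF A _ \<open>c \<noteq> 0\<close> w, of W]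
        dvd_times_prod_Diff_iff[OF A _ \<open>c \<noteq> 0\<close> w, of "{p}" for p]
      by (auto simp: prod_primes_dvd_iff)
  next
    case False
    have "e * \<Prod>(A - W) dvd e * \<Prod>A"
      by (intro mult_dvd_mono dvd_refl prod_dvd_prod_subset) (use A(1) in auto)
    with False show ?thesis using dvd_trans by blast
  qed
  have "of_bool (c dvd e * \<Prod>A \<and> (\<forall>p\<in>A. \<not> c dvd e * \<Prod>(A - {p})))
      = of_bool (c dvd e * \<Prod>A) * (\<Prod>p\<in>A. 1 - (of_bool (c dvd e * \<Prod>(A - {p})) :: complex))"
    using prod_of_bool[OF A(1), of "\<lambda>p. \<not> c dvd e * \<Prod>(A - {p})", where 'c=complex]
    by (simp add: of_bool_conj of_bool_not_iff)
  also have "\<dots> = (\<Sum>W\<in>Pow A. of_bool (c dvd e * \<Prod>A) *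
      ((- 1) ^ card W * (\<Prod>p\<in>W. of_bool (c dvd e * \<Prod>(A - {p}))) * (\<Prod>p\<in>A - W. 1)))"
    by (subst prod_diff_conv_sum[OF A(1)]) (simp add: sum_distrib_left)
  also have "\<dots> = (\<Sum>W\<in>Pow A. (- 1) ^ card W * of_bool (c dvd e * \<Prod>(A - W)))"
  proof (intro sum.cong refl)
    fix W assume "W \<in> Pow A"
    then have W: "W \<subseteq> A" and "finite W" using A(1) by (auto intro: finite_subset)
    then show "of_bool (c dvd e * \<Prod>A) *
      ((- 1) ^ card W * (\<Prod>p\<in>W. of_bool (c dvd e * \<Prod>(A - {p}))) * (\<Prod>p\<in>A - W. 1))
      = (- 1) ^ card W * (of_bool (c dvd e * \<Prod>(A - W)) :: complex)"
      unfolding inter[OF W] by (simp add: prod_of_bool of_bool_conj)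
  qed
  also have "\<dots> = (\<Sum>U\<in>Pow A. (- 1) ^ (card A - card U) * of_bool (c dvd e * \<Prod>U))"
    by (rule sum.reindex_bij_witness[of _ "\<lambda>U. A - U" "\<lambda>W. A - W"])
      (use A(1) in \<open>auto simp: double_diff card_Diff_subset finite_subset card_mono\<close>)
  finally show ?thesis .
qed

text \<open>
  For fixed \<open>U\<close>, the sets \<open>A\<close> containing \<open>U\<close> are \<open>U \<union> V\<close> with \<open>V \<subseteq> P - U\<close>, and summing
  \<open>1 / (\<Prod>p\<in>V. Q p - 1)\<close> over all such \<open>V\<close> gives the product of \<open>1 + 1 / (Q p - 1) = Q p / (Q p - 1)\<close>
  over \<open>P - U\<close>. The factors for \<open>p \<in> U\<close> are \<open>Q p / (Q p - 1)\<close> as well, so the total weight does not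
  depend on \<open>U\<close>.
\<close>

lemma weighted_moebius_cancellation:
  fixes Q :: "'p \<Rightarrow> complex" and D :: "'p set \<Rightarrow> complex"
  assumes P: "finite P" and Q: "\<And>p. p \<in> P \<Longrightarrow> Q p \<noteq> 1"
  shows "(\<Sum>A\<in>Pow P. (- 1) ^ card A * (1 / (\<Prod>p\<in>A. Q p - 1) *
      (\<Sum>U\<in>Pow A. (- 1) ^ (card A - card U) * ((\<Prod>p\<in>U. Q p) * D U))))
    = (\<Prod>p\<in>P. Q p / (Q p - 1)) * (\<Sum>U\<in>Pow P. (- 1) ^ card U * D U)"
proof -
  have fin: "finite A" if "A \<subseteq> P" for A using that P by (rule finite_subset)
  have "(\<Sum>A\<in>Pow P. (- 1) ^ card A * (1 / (\<Prod>p\<in>A. Q p - 1) *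
      (\<Sum>U\<in>Pow A. (- 1) ^ (card A - card U) * ((\<Prod>p\<in>U. Q p) * D U))))
    = (\<Sum>(A, U)\<in>(SIGMA A:Pow P. Pow A). (- 1) ^ card U * D U * (\<Prod>p\<in>U. Q p) * (1 / (\<Prod>p\<in>A. Q p - 1)))"
    unfolding sum_distrib_left
  proof (subst sum.Sigma, use P fin in simp, use fin in simp, intro sum.cong refl, clarify)
    fix A U assume "A \<subseteq> P" "U \<subseteq> A"
    then have "card U \<le> card A" using fin by (intro card_mono) auto
    then have sgn: "(- 1 :: complex) ^ card A * (- 1) ^ (card A - card U) = (- 1) ^ card U"
      by (simp add: power_add[symmetric] uminus_power_if)
    show "(- 1) ^ card A * (1 / (\<Prod>p\<in>A. Q p - 1) * ((- 1) ^ (card A - card U) * ((\<Prod>p\<in>U. Q p) * D U)))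
      = (- 1) ^ card U * D U * (\<Prod>p\<in>U. Q p) * (1 / (\<Prod>p\<in>A. Q p - 1))"
      unfolding sgn[symmetric] by (simp only: ac_simps)
  qed
  also have "\<dots> = (\<Sum>(U, V)\<in>(SIGMA U:Pow P. Pow (P - U)). (- 1) ^ card U * D U * (\<Prod>p\<in>U. Q p) * (1 / (\<Prod>p\<in>U \<union> V. Q p - 1)))"
    by (rule sum.reindex_bij_witness[of _ "\<lambda>(U, V). (U \<union> V, U)" "\<lambda>(A, U). (U, A - U)"])
      (auto simp: Un_absorb1 intro!: arg_cong[where f = "prod _"])
  also have "\<dots> = (\<Sum>U\<in>Pow P. \<Sum>V\<in>Pow (P - U). (- 1) ^ card U * D U * (\<Prod>p\<in>U. Q p) * (1 / (\<Prod>p\<in>U \<union> V. Q p - 1)))"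
    using P by (subst sum.Sigma) auto
  also have "\<dots> = (\<Sum>U\<in>Pow P. (\<Prod>p\<in>P. Q p / (Q p - 1)) * ((- 1) ^ card U * D U))"
  proof (intro sum.cong refl)
    fix U assume "U \<in> Pow P"
    then have U: "U \<subseteq> P" by simp
    have "(\<Sum>V\<in>Pow (P - U). 1 / (\<Prod>p\<in>U \<union> V. Q p - 1))
      = (\<Sum>V\<in>Pow (P - U). (\<Prod>p\<in>U. 1 / (Q p - 1)) * ((\<Prod>p\<in>V. 1 / (Q p - 1)) * (\<Prod>p\<in>P - U - V. 1)))"
    proof (intro sum.cong refl)
      fix V assume "V \<in> Pow (P - U)"
      then have "V \<inter> U = {}" "finite V" by (auto intro: fin)
      then show "1 / (\<Prod>p\<in>U \<union> V. Q p - 1)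
          = (\<Prod>p\<in>U. 1 / (Q p - 1)) * ((\<Prod>p\<in>V. 1 / (Q p - 1)) * (\<Prod>p\<in>P - U - V. 1))"
        using fin[OF U] by (subst prod.union_disjoint) (auto simp: prod_dividef)
    qed
    also have "\<dots> = (\<Prod>p\<in>U. 1 / (Q p - 1)) * (\<Prod>p\<in>P - U. 1 / (Q p - 1) + 1)"
      using P by (simp only: prod_add[of "P - U"] finite_Diff sum_distrib_left)
    also have "(\<Prod>p\<in>P - U. 1 / (Q p - 1) + 1) = (\<Prod>p\<in>P - U. Q p / (Q p - 1))"
      by (intro prod.cong refl) (use Q in \<open>simp add: field_simps\<close>)
    finally have *: "(\<Prod>p\<in>U. Q p) * (\<Sum>V\<in>Pow (P - U). 1 / (\<Prod>p\<in>U \<union> V. Q p - 1))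
        = (\<Prod>p\<in>U. Q p / (Q p - 1)) * (\<Prod>p\<in>P - U. Q p / (Q p - 1))"
      by (simp add: prod_dividef)
    also have "\<dots> = (\<Prod>p\<in>P. Q p / (Q p - 1))"
      by (subst prod.subset_diff[OF U P]) (simp only: mult.commute)
    finally show "(\<Sum>V\<in>Pow (P - U). (- 1) ^ card U * D U * (\<Prod>p\<in>U. Q p) * (1 / (\<Prod>p\<in>U \<union> V. Q p - 1)))
        = (\<Prod>p\<in>P. Q p / (Q p - 1)) * ((- 1) ^ card U * D U)"
      by (simp only: sum_distrib_left[symmetric] mult.assoc) (simp only: ac_simps)
  qed
  finally show ?thesis by (simp only: sum_distrib_left)
qed

section \<open>The characteristic function of \<open>k\<close>-normal elements\<close>

context finite_field_extension
begin

text \<open>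
  The inner double sum of \<open>\<zeta>\<^sub>k\<close> for \<open>h = \<Prod>A\<close>. The restriction on the Orders is replaced by its
  alternating sum of divisibility conditions, to each of which the orthogonality relation applies.
\<close>

lemma sum_characters_of_orders:
  assumes fe: "xm1 = f * e" and f: "lead_coeff f = 1" and A: "A \<subseteq> prime_factors f"
    and d: "\<And>l. la l \<alpha> = 0 \<longleftrightarrow> d dvd l"
  shows "(\<Sum>g\<in>{g \<in> monic_divisors e. gcd (\<Prod>A) (e div g) = 1}.
        \<Sum>\<chi>\<in>chars_of_Order emb (\<Prod>A * g). \<chi> \<alpha>)
    = (\<Sum>U\<in>Pow A. (- 1) ^ (card A - card U) *
        ((\<Prod>p\<in>U. residue_count p) * (residue_count e * of_bool (d * \<Prod>U dvd f))))"
    (is "(\<Sum>g\<in>?G. _) = _")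
proof -
  let ?X = "{\<chi> :: 'b \<Rightarrow> complex. additive_character \<chi>}"
  have A': "finite A" "\<And>p. p \<in> A \<Longrightarrow> prime p" using A by (auto intro: finite_subset)
  have e: "lead_coeff e = 1" using fe f xm1_monic(2) by (metis lead_coeff_mult mult_1)
  then have "e \<noteq> 0" by auto
  have "finite ?G" using finite_monic_divisors[OF \<open>e \<noteq> 0\<close>] by simp
  have X: "finite ?X" by (rule finite_additive_characters)
  have nz: "\<Prod>A \<noteq> 0" using A'(2) by (rule prod_primes_nonzero)
  have "(\<Sum>g\<in>?G. \<Sum>\<chi>\<in>chars_of_Order emb (\<Prod>A * g). \<chi> \<alpha>)
      = (\<Sum>\<chi>\<in>(\<Union>g\<in>?G. chars_of_Order emb (\<Prod>A * g)). \<chi> \<alpha>)"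
    by (rule sum.UNION_disjoint[symmetric])
      (use \<open>finite ?G\<close> X nz in \<open>auto simp: chars_of_Order_def intro: finite_subset\<close>)
  also have "(\<Union>g\<in>?G. chars_of_Order emb (\<Prod>A * g)) = {\<chi> \<in> ?X. \<exists>g\<in>?G. Fq_Order emb \<chi> = \<Prod>A * g}"
    by (auto simp: chars_of_Order_def)
  also have "(\<Sum>\<chi>\<in>\<dots>. \<chi> \<alpha>) = (\<Sum>\<chi>\<in>?X. of_bool (\<exists>g\<in>?G. Fq_Order emb \<chi> = \<Prod>A * g) * \<chi> \<alpha>)"
    using X by (simp add: sum_of_bool_mult_eq Int_def)
  also have "\<dots> = (\<Sum>\<chi>\<in>?X. \<Sum>U\<in>Pow A. (- 1) ^ (card A - card U) * (of_bool (Fq_Order emb \<chi> dvd e * \<Prod>U) * \<chi> \<alpha>))"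
  proof (intro sum.cong refl)
    fix \<chi> assume "\<chi> \<in> ?X"
    then have c: "lead_coeff (Fq_Order emb \<chi>) = 1" by (simp add: lead_coeff_Fq_Order)
    then have "Fq_Order emb \<chi> \<noteq> 0" by auto
    then have "of_bool (\<exists>g\<in>?G. Fq_Order emb \<chi> = \<Prod>A * g)
        = (\<Sum>U\<in>Pow A. (- 1) ^ (card A - card U) * (of_bool (Fq_Order emb \<chi> dvd e * \<Prod>U) :: complex))"
      using order_factorisation_iff[of A e "Fq_Order emb \<chi>"]
        of_bool_order_factorisation[of A "Fq_Order emb \<chi>" e] A' e c by simp
    then show "of_bool (\<exists>g\<in>?G. Fq_Order emb \<chi> = \<Prod>A * g) * \<chi> \<alpha>
        = (\<Sum>U\<in>Pow A. (- 1) ^ (card A - card U) * (of_bool (Fq_Order emb \<chi> dvd e * \<Prod>U) * \<chi> \<alpha>))"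
      by (simp only: sum_distrib_right mult.assoc)
  qed
  also have "\<dots> = (\<Sum>U\<in>Pow A. (- 1) ^ (card A - card U) * (\<Sum>\<chi>\<in>?X. of_bool (Fq_Order emb \<chi> dvd e * \<Prod>U) * \<chi> \<alpha>))"
    by (subst sum.swap) (simp only: sum_distrib_left)
  also have "\<dots> = (\<Sum>U\<in>Pow A. (- 1) ^ (card A - card U) *
        ((\<Prod>p\<in>U. residue_count p) * (residue_count e * of_bool (d * \<Prod>U dvd f))))"
  proof (intro sum.cong refl arg_cong[where f = "\<lambda>x. _ * x"])
    fix U assume "U \<in> Pow A"
    then have U: "finite U" "\<And>p. p \<in> U \<Longrightarrow> prime p" "\<And>p. p \<in> U \<Longrightarrow> p dvd f"
      using A A' by (auto intro: finite_subset)
    have "\<Prod>U dvd f" using prod_primes_dvd_iff[OF U(1,2)] U(3) by blast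
    then obtain f' where f': "f = \<Prod>U * f'" by auto
    have Unz: "\<Prod>U \<noteq> 0" using U(2) by (rule prod_primes_nonzero)
    have "xm1 = (e * \<Prod>U) * f'" using fe f' by (simp only: ac_simps)
    note sum_characters_Order_dvd[OF this, of \<alpha>]
    moreover have "(\<Sum>\<chi>\<in>?X. of_bool (Fq_Order emb \<chi> dvd e * \<Prod>U) * \<chi> \<alpha>)
        = (\<Sum>\<chi> | additive_character \<chi> \<and> Fq_Order emb \<chi> dvd e * \<Prod>U. \<chi> \<alpha>)"
      using X by (simp add: sum_of_bool_mult_eq Int_def)
    moreover have "la f' \<alpha> = 0 \<longleftrightarrow> d * \<Prod>U dvd f"
      unfolding d f' using Unz by (simp add: mult.commute)
    moreover have "residue_count (e * \<Prod>U) = (\<Prod>p\<in>U. residue_count p) * residue_count e"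
      using \<open>e \<noteq> 0\<close> Unz by (simp add: degree_mult_eq power_add power_degree_prod_primes[OF U(2)])
    ultimately show "(\<Sum>\<chi>\<in>?X. of_bool (Fq_Order emb \<chi> dvd e * \<Prod>U) * \<chi> \<alpha>)
        = (\<Prod>p\<in>U. residue_count p) * (residue_count e * of_bool (d * \<Prod>U dvd f))"
      by simp
  qed
  finally show ?thesis .
qed

text \<open>
  If \<open>f = d r\<close>, the sum is the product of \<open>1 - [p | r]\<close> over the prime divisors \<open>p\<close> of \<open>f\<close>, which is
  nonzero only if \<open>r\<close> is a unit.
\<close>

lemma sum_moebius_order:
  fixes d f :: "'a poly"
  assumes d: "lead_coeff d = 1" and f: "lead_coeff f = 1"
  shows "(\<Sum>U\<in>Pow (prime_factors f). (- 1) ^ card U * of_bool (d * \<Prod>U dvd f)) = (of_bool (d = f) :: complex)"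
proof (cases "d dvd f")
  case True
  then obtain r where r: "f = d * r" by auto
  have nz: "d \<noteq> 0" "f \<noteq> 0" using d f by auto
  then have "r \<noteq> 0" using r by auto
  have "(\<Sum>U\<in>Pow (prime_factors f). (- 1) ^ card U * (of_bool (d * \<Prod>U dvd f) :: complex))
      = (\<Sum>U\<in>Pow (prime_factors f). (- 1) ^ card U * (\<Prod>p\<in>U. of_bool (p dvd r)) * (\<Prod>p\<in>prime_factors f - U. 1))"
  proof (intro sum.cong refl)
    fix U assume "U \<in> Pow (prime_factors f)"
    then have U: "finite U" "\<And>p. p \<in> U \<Longrightarrow> prime p" by (auto intro: finite_subset)
    have "d * \<Prod>U dvd f \<longleftrightarrow> (\<forall>p\<in>U. p dvd r)"
      unfolding r using nz(1) prod_primes_dvd_iff[OF U] by simp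
    then show "(- 1) ^ card U * (of_bool (d * \<Prod>U dvd f) :: complex)
        = (- 1) ^ card U * (\<Prod>p\<in>U. of_bool (p dvd r)) * (\<Prod>p\<in>prime_factors f - U. 1)"
      by (simp add: prod_of_bool[OF U(1)])
  qed
  also have "\<dots> = (\<Prod>p\<in>prime_factors f. 1 - of_bool (p dvd r))"
    by (rule prod_diff_conv_sum[symmetric]) simp
  also have "\<dots> = (\<Prod>p\<in>prime_factors f. of_bool (\<not> p dvd r))"
    by (simp add: of_bool_not_iff)
  also have "\<dots> = of_bool (\<forall>p\<in>prime_factors f. \<not> p dvd r)"
    by (rule prod_of_bool) simp
  also have "(\<forall>p\<in>prime_factors f. \<not> p dvd r) \<longleftrightarrow> is_unit r"
  proof
    assume *: "\<forall>p\<in>prime_factors f. \<not> p dvd r"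
    show "is_unit r"
    proof (rule ccontr)
      assume "\<not> is_unit r"
      then obtain p where "prime p" "p dvd r" using prime_divisor_exists[OF \<open>r \<noteq> 0\<close>] by blast
      with * r nz show False by (auto simp: in_prime_factors_iff)
    qed
  next
    assume "is_unit r"
    then show "\<forall>p\<in>prime_factors f. \<not> p dvd r"
      using in_prime_factors_imp_prime not_prime_unit dvd_trans by blast
  qed
  also have "is_unit r \<longleftrightarrow> d = f"
  proof
    assume "is_unit r"
    then have "degree f \<le> degree d" unfolding r using nz \<open>r \<noteq> 0\<close>
      by (simp add: degree_mult_eq is_unit_iff_degree)
    then show "d = f" by (rule monic_dvd_imp_eq[OF True d f])
  qed (use r nz in simp)
  finally show ?thesis .
next
  case False
  then have "\<not> d * \<Prod>U dvd f" for U by (meson dvd_mult_left)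
  with False show ?thesis by auto
qed

lemma zeta_term_eq:
  assumes f: "f \<in> monic_divisors xm1"
    and d: "\<And>l. la l \<alpha> = 0 \<longleftrightarrow> d dvd l" "lead_coeff d = 1"
  shows "of_nat (poly_phi f) / of_nat (CARD('a) ^ m) *
       (\<Sum>h\<in>monic_divisors f. of_int (poly_mu h) / of_nat (poly_phi h) *
          (\<Sum>g\<in>{g \<in> monic_divisors (xm1 div f). gcd h (xm1 div (f * g)) = 1}.
             \<Sum>\<chi>\<in>chars_of_Order emb (h * g). \<chi> \<alpha>)) = of_bool (d = f)"
proof -
  define e where "e = xm1 div f"
  have f_monic: "lead_coeff f = 1" and fe: "xm1 = f * e"
    using f by (auto simp: monic_divisors_def e_def)
  then have nz: "f \<noteq> 0" "e \<noteq> 0" using xm1_nonzero by auto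
  let ?P = "prime_factors f"
  define I where "I h = (\<Sum>g\<in>{g \<in> monic_divisors e. gcd h (e div g) = 1}.
             \<Sum>\<chi>\<in>chars_of_Order emb (h * g). \<chi> \<alpha>)" for h
  define D where "D U = residue_count e * of_bool (d * \<Prod>U dvd f)" for U
  have norm: "residue_count p \<noteq> 1" "residue_count p \<noteq> 0" if "p \<in> ?P" for p
  proof -
    have "CARD('a) ^ degree p > 1"
      using that by (intro card_power_degree_prime_gt_1) auto
    then show "residue_count p \<noteq> 1" "residue_count p \<noteq> 0"
      by (metis less_irrefl of_nat_1 of_nat_eq_iff, simp)
  qed
  have "(\<Sum>h\<in>monic_divisors f. of_int (poly_mu h) / of_nat (poly_phi h) * I h)
      = (\<Sum>h\<in>monic_divisors f. of_int (poly_mu h) * (1 / of_nat (poly_phi h) * I h))"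
    by simp
  also have "\<dots> = (\<Sum>A\<in>Pow ?P. (- 1) ^ card A * (1 / of_nat (poly_phi (\<Prod>A)) * I (\<Prod>A)))"
    using nz(1) by (rule sum_poly_mu_times)
  also have "\<dots> = (\<Sum>A\<in>Pow ?P. (- 1) ^ card A * (1 / (\<Prod>p\<in>A. residue_count p - 1) *
      (\<Sum>U\<in>Pow A. (- 1) ^ (card A - card U) * ((\<Prod>p\<in>U. residue_count p) * D U))))"
  proof (intro sum.cong refl)
    fix A assume "A \<in> Pow ?P"
    then have A: "A \<subseteq> ?P" "finite A" "\<And>p. p \<in> A \<Longrightarrow> prime p" by (auto intro: finite_subset)
    have phi: "of_nat (poly_phi (\<Prod>A)) = (\<Prod>p\<in>A. residue_count p - 1)"
      by (rule poly_phi_prod_primes[OF A(2,3)])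
    show "(- 1) ^ card A * (1 / of_nat (poly_phi (\<Prod>A)) * I (\<Prod>A)) =
        (- 1) ^ card A * (1 / (\<Prod>p\<in>A. residue_count p - 1) *
      (\<Sum>U\<in>Pow A. (- 1) ^ (card A - card U) * ((\<Prod>p\<in>U. residue_count p) * D U)))"
      unfolding phi I_def D_def
        sum_characters_of_orders[OF fe f_monic A(1) d(1)] ..
  qed
  also have "\<dots> = (\<Prod>p\<in>?P. residue_count p / (residue_count p - 1)) * (\<Sum>U\<in>Pow ?P. (- 1) ^ card U * D U)"
    by (rule weighted_moebius_cancellation) (use norm in auto)
  also have "(\<Sum>U\<in>Pow ?P. (- 1) ^ card U * D U) = residue_count e * of_bool (d = f)"
    unfolding sum_moebius_order[OF d(2) f_monic, symmetric] D_def sum_distrib_left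
    by (simp only: ac_simps)
  finally have T: "(\<Sum>h\<in>monic_divisors f. of_int (poly_mu h) / of_nat (poly_phi h) * I h)
      = (\<Prod>p\<in>?P. residue_count p / (residue_count p - 1)) * (residue_count e * of_bool (d = f))" .
  have "(\<Prod>p\<in>?P. 1 - 1 / residue_count p) * (\<Prod>p\<in>?P. residue_count p / (residue_count p - 1))
      = (\<Prod>p\<in>?P. (1 - 1 / residue_count p) * (residue_count p / (residue_count p - 1)))"
    by (simp only: prod.distrib)
  also have "\<dots> = 1"
  proof (rule prod.neutral, rule ballI)
    fix p assume "p \<in> ?P"
    from norm[OF this] show "(1 - 1 / residue_count p) * (residue_count p / (residue_count p - 1)) = 1"
      by (simp add: field_simps)
  qed
  finally have inv: "(\<Prod>p\<in>?P. 1 - 1 / residue_count p) * (\<Prod>p\<in>?P. residue_count p / (residue_count p - 1)) = 1" .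
  have "m = degree f + degree e" using fe nz xm1_monic(1) by (metis degree_mult_eq)
  then have qm: "residue_count f * residue_count e = of_nat (CARD('a) ^ m)"
    by (simp add: power_add)
  have "xm1 div (f * g) = e div g" for g
    using nz(1) by (simp add: fe div_mult_mult1)
  then have "of_nat (poly_phi f) / of_nat (CARD('a) ^ m) *
       (\<Sum>h\<in>monic_divisors f. of_int (poly_mu h) / of_nat (poly_phi h) *
          (\<Sum>g\<in>{g \<in> monic_divisors (xm1 div f). gcd h (xm1 div (f * g)) = 1}.
             \<Sum>\<chi>\<in>chars_of_Order emb (h * g). \<chi> \<alpha>))
      = of_nat (poly_phi f) / of_nat (CARD('a) ^ m) *
       (\<Sum>h\<in>monic_divisors f. of_int (poly_mu h) / of_nat (poly_phi h) * I h)"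
    by (simp only: I_def e_def[symmetric])
  also have "\<dots> = ((\<Prod>p\<in>?P. 1 - 1 / residue_count p) * (\<Prod>p\<in>?P. residue_count p / (residue_count p - 1)))
      * ((residue_count f * residue_count e) / of_nat (CARD('a) ^ m)) * of_bool (d = f)"
    unfolding T poly_phi_eq[OF nz(1)] by (simp only: divide_inverse ac_simps)
  also have "\<dots> = of_bool (d = f)"
    unfolding inv qm by simp
  finally show ?thesis .
qed

end

theorem theorem4p4:
  fixes emb :: "'a::{field_gcd,finite} \<Rightarrow> 'b::{field_gcd,finite}"
    and m k :: nat and \<alpha> :: 'b
  assumes emb_one: "emb 1 = 1"
    and emb_add: "\<And>x y. emb (x + y) = emb x + emb y"
    and emb_mult: "\<And>x y. emb (x * y) = emb x * emb y"
    and card_ext: "CARD('b) = CARD('a) ^ m"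
    and m_pos: "m \<ge> 1"
    and k_le: "k \<le> m"
  shows "zeta emb m k \<alpha> = (if k_normal CARD('a) m k \<alpha> then 1 else 0)"
proof -
  interpret finite_field_extension emb m
    using assms by unfold_locales
  obtain d where d: "lead_coeff d = 1" "\<And>l. la l \<alpha> = 0 \<longleftrightarrow> d dvd l"
    using element_order by blast
  let ?F = "{f \<in> monic_divisors xm1. degree f = m - k}"
  have "finite ?F" using finite_monic_divisors[OF xm1_nonzero] by simp
  have "d \<in> monic_divisors xm1" using d by (simp add: monic_divisors_def flip: d(2))
  have "zeta emb m k \<alpha> = (\<Sum>f\<in>?F. of_bool (d = f))"
    unfolding zeta_def by (intro sum.cong refl zeta_term_eq d) simp
  also have "\<dots> = of_bool (degree d = m - k)"
    using \<open>finite ?F\<close> \<open>d \<in> monic_divisors xm1\<close> by (simp add: of_bool_def)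
  also have "degree d = m - k \<longleftrightarrow> k_normal CARD('a) m k \<alpha>"
    using degree_gcd_normal_poly[OF d(2,1)] k_le unfolding k_normal_def by linarith
  finally show ?thesis by simp
qed

end
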